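(* Let $p$ be a prime, let $R$ be a unique factorization domain containing a field of characteristic $p$ which is not a field, and let $k$ be its field of fractions. Let $l\ge 0$ and let $R[x,y,\boldsymbol{z}]$, $\boldsymbol z=z_1,\ldots,z_l$, be the polynomial ring in $2+l$ variables. Let $u\in R\setminus(R^*\cup\{0\})$ and let $d\ge 2$ be an integer not divisible by $p$. Put $$a:=p-2+(p-1)^2(d-1),\qquad b:=(p+1)(d-1)+1,$$ $$\lambda:=u^{-p-1}y^{p(p-1)}+u^{-2}y^{pa+1},\qquad \widetilde{x}:=x+\lambda,\qquad \widetilde{y}:=y+\widetilde{x}^d,$$ so that $k[x,y,\boldsymbol z]=k[\widetilde x,\widetilde y,\boldsymbol z]$. Let $g\in R[u^{(p+1)d}\widetilde y,\boldsymbol z]$ and let $\sigma^g\in\mathrm{Aut}_R R[x,y,\boldsymbol z]$ be the restriction to $R[x,y,\boldsymbol z]$ of the $k$-algebra automorphism of $k[x,y,\boldsymbol z]$ given by $\widetilde x\mapsto \widetilde x+u^b(1+ug)$, $\widetilde y\mapsto\widetilde y$, $z_i\mapsto z_i$ ($i=1,\ldots,l$); this automorphism does restrict to $R[x,y,\boldsymbol z]$. If $k[\widetilde y,\boldsymbol z]$ is $(1+ug)$-stable over $k$, then $\sigma^g$ is not exponential over $R$.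
   Context: All rings are integral domains containing a field of characteristic $p>0$. A $\mathbf{G}_a$-action on a ring $B$ is a ring homomorphism $E:B\to B[T]$ ($T$ a variable) such that: (A1) $E$ followed by $T\mapsto 0$ is the identity of $B$; (A2) if $E(b)=\sum_i b_iT^i$, then $\sum_i E(b_i)|_{T=T_1}\,T_2^i=\sum_i b_i(T_1+T_2)^i$ in $B[T_1,T_2]$, for all $b\in B$. Its invariant ring is $B^E=\{b\in B\mid E(b)=b\}$. For $a\in B^E$, $E_a:B\to B$ is $E$ followed by $T\mapsto a$; it is an automorphism of $B$. For a subring $R\subset B$, $E$ is over $R$ if $R\subset B^E$. An automorphism $\sigma$ of $B$ is exponential over $R$ if $\sigma=E_a$ for some $\mathbf{G}_a$-action $E$ on $B$ over $R$ and some $a\in B^E$. $f$-stability: let $A$ be a ring, $f\in A\setminus\{0\}$, $R_0$ a subring of $A$, $X$ a variable, and let $\epsilon$ be the $A$-algebra automorphism of the polynomial ring $A[X]$ with $\epsilon(X)=X+f$. $A$ is $f$-stable over $R_0$ if every $\mathbf{G}_a$-action $E$ on $A[X]$ over $R_0$ with $E_1=\epsilon$ satisfies $A[X]^E=A$. *)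

theory Defs
  imports
    "HOL-Computational_Algebra.Computational_Algebra"
    "HOL-Library.Poly_Mapping"
begin

text \<open>
  Rings are subrings (as sets) of an ambient integral domain. The polynomial ring \<open>B[T]\<close> over a
  subring \<open>B\<close> is the set of univariate polynomials with all coefficients in \<open>B\<close>; polynomials in
  \<open>T\<^sub>1, T\<^sub>2\<close> are polynomials in \<open>T\<^sub>2\<close> whose coefficients are polynomials in \<open>T\<^sub>1\<close>.
  Functions between rings are functions on the ambient type, and only their values on the
  subring in question matter.
\<close>

definition is_subring :: "'a::comm_ring_1 set \<Rightarrow> bool" where
  "is_subring S \<longleftrightarrow> 1 \<in> S \<and> (\<forall>a\<in>S. \<forall>b\<in>S. a - b \<in> S \<and> a * b \<in> S)"

definition adjoin :: "'a::comm_ring_1 set \<Rightarrow> 'a set \<Rightarrow> 'a set" where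
  "adjoin S V = is_subring hull (S \<union> V)"

definition polys_over :: "'a::zero set \<Rightarrow> 'a poly set" where
  "polys_over B = {q. \<forall>i. coeff q i \<in> B}"

definition ring_hom_on :: "'a::comm_ring_1 set \<Rightarrow> ('a \<Rightarrow> 'b::comm_ring_1) \<Rightarrow> bool" where
  "ring_hom_on B \<phi> \<longleftrightarrow> \<phi> 1 = 1 \<and>
     (\<forall>a\<in>B. \<forall>b\<in>B. \<phi> (a + b) = \<phi> a + \<phi> b \<and> \<phi> (a * b) = \<phi> a * \<phi> b)"

definition alg_automorphism :: "'a::comm_ring_1 set \<Rightarrow> 'a set \<Rightarrow> ('a \<Rightarrow> 'a) \<Rightarrow> bool" where
  "alg_automorphism S B \<sigma> \<longleftrightarrow>
     ring_hom_on B \<sigma> \<and> bij_betw \<sigma> B B \<and> (\<forall>s\<in>S. \<sigma> s = s)"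

text \<open>The last two conjuncts are (A1) and (A2); in (A2), \<open>T\<^sub>1 = [:[:0, 1:]:]\<close> and \<open>T\<^sub>2 = [:0, 1:]\<close>.\<close>

definition Ga_action :: "'a::idom set \<Rightarrow> ('a \<Rightarrow> 'a poly) \<Rightarrow> bool" where
  "Ga_action B E \<longleftrightarrow>
     E ` B \<subseteq> polys_over B \<and> ring_hom_on B E \<and>
     (\<forall>b\<in>B. poly (E b) 0 = b) \<and>
     (\<forall>b\<in>B. (\<Sum>i\<le>degree (E b). [:E (coeff (E b) i):] * [:0, 1:] ^ i) =
             (\<Sum>i\<le>degree (E b). [:[:coeff (E b) i:]:] * ([:[:0, 1:]:] + [:0, 1:]) ^ i))"

definition invariant_ring :: "'a::idom set \<Rightarrow> ('a \<Rightarrow> 'a poly) \<Rightarrow> 'a set" where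
  "invariant_ring B E = {b \<in> B. E b = [:b:]}"

definition Ga_action_over :: "'a::idom set \<Rightarrow> 'a set \<Rightarrow> ('a \<Rightarrow> 'a poly) \<Rightarrow> bool" where
  "Ga_action_over S B E \<longleftrightarrow> Ga_action B E \<and> S \<subseteq> invariant_ring B E"

definition specialize :: "('a::idom \<Rightarrow> 'a poly) \<Rightarrow> 'a \<Rightarrow> 'a \<Rightarrow> 'a" where
  "specialize E a b = poly (E b) a"

definition exponential_over :: "'a::idom set \<Rightarrow> 'a set \<Rightarrow> ('a \<Rightarrow> 'a) \<Rightarrow> bool" where
  "exponential_over S B \<sigma> \<longleftrightarrow>
     (\<exists>E a. Ga_action_over S B E \<and> a \<in> invariant_ring B E \<and> (\<forall>b\<in>B. \<sigma> b = specialize E a b))"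

text \<open>
  Here \<open>A[X]\<close> is \<open>polys_over A\<close>, with \<open>A\<close> and \<open>S\<close> embedded in it as constant polynomials; the
  automorphism with \<open>X \<mapsto> X + f\<close> is \<open>q \<mapsto> pcompose q [:f, 1:]\<close>.
\<close>

definition f_stable_over :: "'a::idom \<Rightarrow> 'a set \<Rightarrow> 'a set \<Rightarrow> bool" where
  "f_stable_over f S A \<longleftrightarrow>
     is_subring A \<and> is_subring S \<and> S \<subseteq> A \<and> f \<in> A - {0} \<and>
     (\<forall>E. Ga_action_over ((\<lambda>c. [:c:]) ` S) (polys_over A) E \<and>
          (\<forall>q\<in>polys_over A. specialize E 1 q = pcompose q [:f, 1:])
          \<longrightarrow> invariant_ring (polys_over A) E = (\<lambda>c. [:c:]) ` A)"

text \<open>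
  Multivariate polynomials over a field \<open>k\<close> in variables indexed by \<^typ>\<open>nat\<close> (exponent vectors
  are finitely supported functions). Polynomial rings in finitely many of the variables, over
  \<open>k\<close> or over a subring of \<open>k\<close>, are obtained with \<^const>\<open>adjoin\<close>.
\<close>

type_synonym 'k mpolys = "(nat \<Rightarrow>\<^sub>0 nat) \<Rightarrow>\<^sub>0 'k"

definition Const :: "'k::field \<Rightarrow> 'k mpolys" where
  "Const c = Poly_Mapping.single 0 c"

definition Var :: "nat \<Rightarrow> 'k::field mpolys" where
  "Var i = Poly_Mapping.single (Poly_Mapping.single i 1) 1"

end

theory Submission
  imports Defs
begin

text \<open>
  Suppose \<open>\<sigma>\<^sup>g = E\<^sub>c\<close>. After extending scalars to \<open>k\<close> and rescaling \<open>T\<close> by \<open>c\<close>, the action \<open>E\<close> becomes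
  an action on \<open>A[X]\<close>, \<open>A = k[y\<^sub>t, z]\<close>, \<open>X = x\<^sub>t / u\<^sup>b\<close>, whose value at \<open>T = 1\<close> is
  \<open>X \<mapsto> X + (1 + u g)\<close>, so stability forces \<open>E(y\<^sub>t) = y\<^sub>t\<close>. Fix a prime \<open>q\<close> dividing \<open>u\<close> exactly
  \<open>e\<close> times, and write \<open>W = u\<^bsup>p+1\<^esup> x\<^sub>t\<close>, \<open>E(W) = W + P\<close>, \<open>E(y) = y + H\<close>, where \<open>P\<close> and \<open>H\<close> vanish
  at \<open>T = 0\<close>. Invariance of \<open>y\<^sub>t\<close> reads \<open>u\<^bsup>(p+1)d\<^esup> H = W\<^sup>d - (W + P)\<^sup>d\<close>; since \<open>q\<close> divides
  neither \<open>d\<close> nor \<open>W\<close>, \<open>P\<close> and \<open>u\<^bsup>(p+1)d\<^esup> H\<close> contain the same power of \<open>q\<close>, and the value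
  \<open>P(c) = u\<^bsup>(p+1)d+1\<^esup> (1 + u g)\<close> gives \<open>H = q\<^sup>n H'\<close> with \<open>n \<le> e\<close> and \<open>q\<close> not dividing \<open>H'\<close>.
  Integrality of \<open>E(x)\<close> then makes \<open>q\<close> divide \<open>H'\<^bsup>p-1\<^esup> N\<^sub>1 + q\<^bsup>(e-n)(p-1)\<^esup> (\<dots>)\<close> with
  \<open>N\<^sub>1 = -y\<^bsup>p(p-2)\<^esup>\<close> at \<open>T = 0\<close>, and setting \<open>T = 0\<close> yields a contradiction both for \<open>n < e\<close> and
  for \<open>n = e\<close>.

  That \<open>\<sigma>\<^sup>g\<close> maps \<open>R[x, y, z]\<close> into itself is a congruence modulo \<open>u\<close>; it is onto because
  \<open>\<sigma>\<^sup>g\<close> has order dividing \<open>p\<close>.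
\<close>

section \<open>Polynomials as finitely supported functions\<close>

abbreviation lookup where "lookup \<equiv> Poly_Mapping.lookup"
abbreviation keys where "keys \<equiv> Poly_Mapping.keys"
abbreviation single where "single \<equiv> Poly_Mapping.single"

section \<open>Products, leading terms and primes of the coefficient ring\<close>

lemma poly_mapping_sum_singles:
  fixes f :: "'a \<Rightarrow>\<^sub>0 'b::comm_monoid_add"
  shows "f = (\<Sum>m\<in>keys f. single m (lookup f m))"
proof (rule poly_mapping_eqI)
  fix n
  have "(\<Sum>m\<in>keys f. lookup (single m (lookup f m)) n) = (\<Sum>m\<in>keys f. if n = m then lookup f n else 0)"
    by (rule sum.cong) (auto simp: lookup_single when_def)
  also have "\<dots> = lookup f n"
    by (simp add: in_keys_iff)
  finally show "lookup f n = lookup (\<Sum>m\<in>keys f. single m (lookup f m)) n"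
    by (simp add: lookup_sum)
qed

lemma mult_sum_singles:
  fixes f g :: "'a::comm_monoid_add \<Rightarrow>\<^sub>0 'b::comm_semiring_1"
  shows "f * g = (\<Sum>m\<in>keys f. \<Sum>n\<in>keys g. single (m + n) (lookup f m * lookup g n))"
  using arg_cong2[OF poly_mapping_sum_singles[of f] poly_mapping_sum_singles[of g], of "(*)"]
  by (simp only: sum_product mult_single)

lemma lookup_mult_keys:
  fixes f g :: "'a::comm_monoid_add \<Rightarrow>\<^sub>0 'b::comm_semiring_1"
  shows "lookup (f * g) k = (\<Sum>m\<in>keys f. \<Sum>n\<in>keys g. lookup f m * lookup g n when m + n = k)"
  by (subst mult_sum_singles) (simp add: lookup_sum lookup_single)

text \<open>Addition of exponents is strictly monotone for a total order, so the sum of the two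
  largest exponents arises from no other pair: leading coefficients multiply.\<close>

lemma lookup_mult_Max_keys:
  fixes f g :: "'a::{ordered_cancel_comm_monoid_add, linorder} \<Rightarrow>\<^sub>0 'b::comm_semiring_1"
  assumes "f \<noteq> 0" "g \<noteq> 0"
  shows "lookup (f * g) (Max (keys f) + Max (keys g)) = lookup f (Max (keys f)) * lookup g (Max (keys g))"
proof -
  let ?M = "Max (keys f)" and ?N = "Max (keys g)"
  have ne: "keys f \<noteq> {}" "keys g \<noteq> {}"
    using assms by (metis poly_mapping_sum_singles sum.empty)+
  have eq: "m = ?M \<and> n = ?N" if "m \<in> keys f" "n \<in> keys g" "m + n = ?M + ?N" for m n
  proof -
    have le: "m \<le> ?M" "n \<le> ?N" using that by auto
    show ?thesis
      using le that(3) add_less_le_mono[of m ?M n ?N] add_le_less_mono[of m ?M n ?N]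
      by (metis order_le_less less_irrefl)
  qed
  have "lookup (f * g) (?M + ?N)
      = (\<Sum>m\<in>keys f. \<Sum>n\<in>keys g. if m = ?M \<and> n = ?N then lookup f m * lookup g n else 0)"
    unfolding lookup_mult_keys using eq by (intro sum.cong refl) (auto simp: when_def)
  also have "\<dots> = (\<Sum>m\<in>keys f. if m = ?M then lookup f m * lookup g ?N else 0)"
  proof (rule sum.cong[OF refl])
    fix m
    have "(\<Sum>n\<in>keys g. if m = ?M \<and> n = ?N then lookup f m * lookup g n else 0)
        = (\<Sum>n\<in>keys g. if n = ?N then (if m = ?M then lookup f m * lookup g n else 0) else 0)"
      by (rule sum.cong) auto
    then show "(\<Sum>n\<in>keys g. if m = ?M \<and> n = ?N then lookup f m * lookup g n else 0)
        = (if m = ?M then lookup f m * lookup g ?N else 0)"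
      using Max_in[OF finite_keys ne(2)] by (simp add: sum.delta)
  qed
  also have "\<dots> = lookup f ?M * lookup g ?N"
    using Max_in[OF finite_keys ne(1)] by (simp add: sum.delta)
  finally show ?thesis .
qed

lemma const_mult_lookup:
  fixes f :: "'a::comm_monoid_add \<Rightarrow>\<^sub>0 'b::comm_semiring_1"
  shows "lookup (single 0 c * f) k = c * lookup f k"
proof -
  have "lookup (single 0 c * f) k = (\<Sum>n\<in>keys f. if n = k then c * lookup f k else 0)"
    by (cases "c = 0") (auto simp: lookup_mult_keys when_def intro!: sum.cong)
  then show ?thesis by (simp add: in_keys_iff)
qed

lemma const_dvd_iff:
  fixes f :: "'a::comm_monoid_add \<Rightarrow>\<^sub>0 'b::comm_semiring_1"
  shows "single 0 c dvd f \<longleftrightarrow> (\<forall>m. c dvd lookup f m)"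
proof
  assume "single 0 c dvd f"
  then show "\<forall>m. c dvd lookup f m" by (auto simp: const_mult_lookup)
next
  assume *: "\<forall>m. c dvd lookup f m"
  have "single 0 c dvd (\<Sum>m\<in>keys f. single m (lookup f m))"
  proof (rule dvd_sum)
    fix m
    obtain e where "lookup f m = c * e" using * by (meson dvdE)
    then have "single m (lookup f m) = single 0 c * single m e" by (simp add: mult_single)
    then show "single 0 c dvd single m (lookup f m)" by simp
  qed
  then show "single 0 c dvd f" using poly_mapping_sum_singles[of f] by simp
qed

lemma poly_mapping_split_dvd:
  fixes f :: "'a::comm_monoid_add \<Rightarrow>\<^sub>0 'b::comm_semiring_1"
  obtains f1 f2 where "f = f1 + f2" "single 0 c dvd f2" "\<And>m. m \<in> keys f1 \<Longrightarrow> \<not> c dvd lookup f1 m"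
proof
  define f1 where "f1 = (\<Sum>m | m \<in> keys f \<and> \<not> c dvd lookup f m. single m (lookup f m))"
  define f2 where "f2 = (\<Sum>m | m \<in> keys f \<and> c dvd lookup f m. single m (lookup f m))"
  have l1: "lookup f1 k = (if c dvd lookup f k then 0 else lookup f k)" for k
  proof -
    have "lookup f1 k = (\<Sum>m | m \<in> keys f \<and> \<not> c dvd lookup f m. if m = k then lookup f k else 0)"
      unfolding f1_def lookup_sum by (rule sum.cong) (auto simp: lookup_single when_def)
    then show ?thesis by (auto simp: in_keys_iff)
  qed
  have l2: "lookup f2 k = (if c dvd lookup f k then lookup f k else 0)" for k
  proof -
    have "lookup f2 k = (\<Sum>m | m \<in> keys f \<and> c dvd lookup f m. if m = k then lookup f k else 0)"
      unfolding f2_def lookup_sum by (rule sum.cong) (auto simp: lookup_single when_def)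
    then show ?thesis by (auto simp: in_keys_iff)
  qed
  show "f = f1 + f2" by (rule poly_mapping_eqI) (simp add: lookup_add l1 l2)
  show "single 0 c dvd f2" by (simp add: const_dvd_iff l2)
  show "\<not> c dvd lookup f1 m" if "m \<in> keys f1" for m
    using that by (auto simp: in_keys_iff l1 split: if_splits)
qed

text \<open>Gauss's argument: remove from both factors the terms whose coefficients \<open>q\<close>
  divides. If neither factor becomes zero, the remaining leading coefficients are not divisible by
  \<open>q\<close>, hence neither is their product.\<close>

lemma prime_elem_single:
  fixes q :: "'b::comm_ring_1"
  assumes q: "prime_elem q"
  shows "prime_elem (single 0 q :: 'a::{ordered_cancel_comm_monoid_add, linorder} \<Rightarrow>\<^sub>0 'b)"
proof (rule prime_elemI)
  let ?q = "single 0 q :: 'a \<Rightarrow>\<^sub>0 'b"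
  show "?q \<noteq> 0" using q by (metis lookup_single_eq lookup_zero prime_elem_not_zeroI)
  show "\<not> ?q dvd 1" using q by (auto simp: const_dvd_iff lookup_one prime_elem_def intro!: exI[of _ 0])
  fix f g :: "'a \<Rightarrow>\<^sub>0 'b"
  assume fg: "?q dvd f * g"
  obtain f1 f2 where f: "f = f1 + f2" "?q dvd f2" "\<And>m. m \<in> keys f1 \<Longrightarrow> \<not> q dvd lookup f1 m"
    using poly_mapping_split_dvd[where c = q and f = f] by metis
  obtain g1 g2 where g: "g = g1 + g2" "?q dvd g2" "\<And>m. m \<in> keys g1 \<Longrightarrow> \<not> q dvd lookup g1 m"
    using poly_mapping_split_dvd[where c = q and f = g] by metis
  show "?q dvd f \<or> ?q dvd g"
  proof (rule ccontr)
    assume "\<not> ?thesis"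
    then have ne: "f1 \<noteq> 0" "g1 \<noteq> 0" using f g by auto
    then have k: "Max (keys f1) \<in> keys f1" "Max (keys g1) \<in> keys g1"
      by (metis Max_in finite_keys poly_mapping_sum_singles sum.empty)+
    have "f1 * g1 = f * g - f * g2 - f2 * g1" by (simp add: f(1) g(1) algebra_simps)
    then have "?q dvd f1 * g1" using fg f(2) g(2) by (metis dvd_diff dvd_mult dvd_mult2)
    then have "q dvd lookup f1 (Max (keys f1)) * lookup g1 (Max (keys g1))"
      unfolding const_dvd_iff using lookup_mult_Max_keys[OF ne] by metis
    then show False using f(3)[OF k(1)] g(3)[OF k(2)] q by (simp add: prime_elem_dvd_mult_iff)
  qed
qed

section \<open>Substitution homomorphisms on multivariate polynomials\<close>

definition monom_subst :: "('v \<Rightarrow> 'c::comm_semiring_1) \<Rightarrow> ('v \<Rightarrow>\<^sub>0 nat) \<Rightarrow> 'c" where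
  "monom_subst v m = (\<Prod>i\<in>keys m. v i ^ lookup m i)"

definition mpoly_subst :: "('b::comm_semiring_1 \<Rightarrow> 'c::comm_semiring_1) \<Rightarrow> ('v \<Rightarrow> 'c) \<Rightarrow> (('v \<Rightarrow>\<^sub>0 nat) \<Rightarrow>\<^sub>0 'b) \<Rightarrow> 'c" where
  "mpoly_subst h v f = (\<Sum>m\<in>keys f. h (lookup f m) * monom_subst v m)"

lemma monom_subst_superset:
  assumes "finite A" "keys m \<subseteq> A"
  shows "monom_subst v m = (\<Prod>i\<in>A. v i ^ lookup m i)"
  unfolding monom_subst_def using assms
  by (intro prod.mono_neutral_left) (auto simp: in_keys_iff)

lemma monom_subst_add: "monom_subst v (m + n) = monom_subst v m * monom_subst v n"
proof -
  have s: "keys (m + n) \<subseteq> keys m \<union> keys n" by (rule keys_add)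
  show ?thesis
    using monom_subst_superset[of "keys m \<union> keys n" "m + n" v]
      monom_subst_superset[of "keys m \<union> keys n" m v] monom_subst_superset[of "keys m \<union> keys n" n v] s
    by (simp add: lookup_add power_add prod.distrib)
qed

text \<open>Stated for arbitrary \<open>h\<close> and \<open>v\<close> because two evaluations need
  it: \<open>fract_mpoly\<close>, which embeds polynomials over \<open>'r\<close>, and
  \<open>\<theta>\<close>, which rewrites k[x, y, z] as a polynomial ring in one variable over
  \<open>A\<close>.\<close>

locale coeff_hom =
  fixes h :: "'b::comm_ring_1 \<Rightarrow> 'c::comm_ring_1" and v :: "'v \<Rightarrow> 'c"
  assumes h0: "h 0 = 0" and h1: "h 1 = 1"
    and h_add: "h (r + s) = h r + h s" and h_mult: "h (r * s) = h r * h s"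
begin

lemma superset:
  assumes "finite A" "keys f \<subseteq> A"
  shows "mpoly_subst h v f = (\<Sum>m\<in>A. h (lookup f m) * monom_subst v m)"
  unfolding mpoly_subst_def using assms
  by (intro sum.mono_neutral_left) (auto simp: in_keys_iff h0)

lemma add: "mpoly_subst h v (f + g) = mpoly_subst h v f + mpoly_subst h v g"
proof -
  have s: "keys (f + g) \<subseteq> keys f \<union> keys g" by (rule keys_add)
  show ?thesis
    using superset[of "keys f \<union> keys g" "f + g"] superset[of "keys f \<union> keys g" f]
      superset[of "keys f \<union> keys g" g] s
    by (simp add: lookup_add h_add distrib_right sum.distrib)
qed

lemma single: "mpoly_subst h v (single m c) = h c * monom_subst v m"
  by (cases "c = 0") (simp_all add: mpoly_subst_def h0)

lemma zero: "mpoly_subst h v 0 = 0"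
  by (simp add: mpoly_subst_def)

lemma sum: "mpoly_subst h v (sum F A) = (\<Sum>a\<in>A. mpoly_subst h v (F a))"
  by (induction A rule: infinite_finite_induct) (simp_all add: add zero)

lemma mult: "mpoly_subst h v (f * g) = mpoly_subst h v f * mpoly_subst h v g"
proof -
  have "mpoly_subst h v (f * g)
      = (\<Sum>m\<in>keys f. \<Sum>n\<in>keys g. (h (lookup f m) * monom_subst v m) * (h (lookup g n) * monom_subst v n))"
    by (subst mult_sum_singles) (simp add: sum single h_mult monom_subst_add mult_ac)
  then show ?thesis by (simp only: mpoly_subst_def sum_product)
qed

lemma const: "mpoly_subst h v (single 0 c) = h c"
  by (simp add: single monom_subst_def)

lemma one: "mpoly_subst h v 1 = 1"
  using const[of 1] h1 by simp

lemma var: "mpoly_subst h v (single (single i 1) 1) = v i"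
  by (simp add: single monom_subst_def h1)

end

lemma monom_subst_Var: "monom_subst Var m = (single m 1 :: 'k::field mpolys)"
proof -
  have pow: "(Var i :: 'k mpolys) ^ n = single (single i n) 1" for i n
    by (induction n) (simp_all add: Var_def mult_single flip: single_add)
  have fin: "(\<Prod>i\<in>A. single (single i (lookup m i)) (1::'k)) = single (\<Sum>i\<in>A. single i (lookup m i)) 1"
    if "finite A" for A
    using that by (induction A rule: finite_induct) (simp_all add: mult_single)
  show ?thesis
    unfolding monom_subst_def pow by (simp add: fin flip: poly_mapping_sum_singles)
qed

section \<open>The divisibility argument\<close>

text \<open>By Frobenius \<open>(y + h) ^ p = y ^ p + h ^ p\<close>, so this geometric sum is the
  cofactor of \<open>h ^ p\<close> in \<open>(y + h) ^ (p * m) - y ^ (p * m)\<close>. Written as a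
  sum, it also makes sense at \<open>h = 0\<close>.\<close>

definition pow_quot :: "nat \<Rightarrow> nat \<Rightarrow> 'a::comm_ring_1 \<Rightarrow> 'a \<Rightarrow> 'a" where
  "pow_quot p m y h = (\<Sum>i<m. (y ^ p) ^ (m - Suc i) * (y ^ p + h ^ p) ^ i)"

lemma pow_char_mult_diff:
  fixes y h :: "'a::comm_ring_1"
  assumes "prime p" "CHAR('a) = p"
  shows "(y + h) ^ (p * m) - y ^ (p * m) = h ^ p * pow_quot p m y h"
proof -
  have "(y + h) ^ p = y ^ p + h ^ p" using assms by (intro freshmans_dream) auto
  then show ?thesis
    by (simp only: power_mult power_diff_sumr2[of _ m] pow_quot_def) simp
qed

text \<open>The exponent \<open>p * m + 1\<close> is what brings in a term linear in
  \<open>h\<close>; everything else is divisible by \<open>h ^ p\<close>. The interplay of these two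
  orders decides both the integrality of \<open>\<sigma>\<close> and the final
  contradiction.\<close>

lemma pow_char_mult_Suc_diff:
  fixes y h :: "'a::comm_ring_1"
  assumes "prime p" "CHAR('a) = p"
  shows "(y + h) ^ (p * m + 1) - y ^ (p * m + 1) = y ^ (p * m) * h + h ^ p * ((y + h) * pow_quot p m y h)"
proof -
  have eq: "(y + h) ^ (p * m) = y ^ (p * m) + h ^ p * pow_quot p m y h"
    using pow_char_mult_diff[OF assms, of y h m] by (simp add: algebra_simps)
  show ?thesis unfolding power_add eq by (simp add: algebra_simps)
qed

lemma pow_quot_0:
  assumes "p > 0"
  shows "pow_quot p m y 0 = of_nat m * (y ^ p) ^ (m - 1)"
proof -
  have "pow_quot p m y 0 = (\<Sum>i<m. (y ^ p) ^ (m - 1))"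
    unfolding pow_quot_def
  proof (rule sum.cong[OF refl])
    fix i assume "i \<in> {..<m}"
    then have "m - Suc i + i = m - 1" by auto
    then show "(y ^ p) ^ (m - Suc i) * (y ^ p + 0 ^ p) ^ i = (y ^ p) ^ (m - 1)"
      using assms by (simp flip: power_add add: zero_power)
  qed
  then show ?thesis by simp
qed

lemma poly_pow_quot: "poly (pow_quot p m F H) c = pow_quot p m (poly F c) (poly H c)"
  by (simp add: pow_quot_def poly_sum)

text \<open>Bezout gives \<open>d * x = 1 + p * y\<close>, and \<open>p\<close> is zero in the ring.
  No prime divides a unit, which settles the integer factors \<open>d\<close> and
  \<open>p - 1\<close> below.\<close>

lemma of_nat_unit_mod_CHAR:
  assumes "prime p" "CHAR('a::comm_ring_1) = p" "\<not> p dvd d"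
  shows "of_nat d dvd (1::'a)"
proof -
  obtain x y where "d * x = Suc (p * y)" using bezout_prime[OF assms(1,3)] by blast
  then have "(of_nat (d * x) :: 'a) = of_nat (Suc (p * y))" by (rule arg_cong)
  also have "\<dots> = 1" using assms(2) by (simp add: of_nat_CHAR flip: assms(2))
  finally have "(of_nat (d * x) :: 'a) = 1" .
  then show ?thesis by (metis dvd_triv_left of_nat_mult)
qed

text \<open>One factor \<open>q\<close> at a time: cancel \<open>q ^ n\<close>, then primality moves
  the remaining \<open>q\<close> into the cofactor of \<open>P\<close>.\<close>

lemma prime_elem_power_dvd_mult_cancel:
  fixes q P m :: "'a::idom"
  assumes "prime_elem q" "\<not> q dvd m" "q ^ n dvd P * m"
  shows "q ^ n dvd P"
  using assms(3)
proof (induction n)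
  case (Suc n)
  then have "q ^ n dvd P" by (metis dvd_trans le_imp_power_dvd le_add2 plus_1_eq_Suc)
  then obtain P' where P': "P = q ^ n * P'" by (elim dvdE)
  have "q ^ n * q dvd q ^ n * (P' * m)"
    using Suc.prems P' by (simp add: mult_ac)
  moreover have "q ^ n \<noteq> 0" using assms(1) by (simp add: prime_elem_def)
  ultimately have "q dvd P' * m" by (simp only: dvd_mult_cancel_left) simp
  then have "q dvd P'" using assms(1,2) by (simp add: prime_elem_dvd_mult_iff)
  then show ?case by (simp add: P' mult_dvd_mono)
qed simp

lemma const_poly_dvd_imp_dvd_poly:
  fixes F :: "'a::comm_ring_1 poly"
  shows "[:q:] dvd F \<Longrightarrow> q dvd poly F c"
  by (auto elim!: dvdE)

text \<open>In the application \<open>'c\<close> is a polynomial ring over the factorial ring, the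
  polynomial variable is T, and \<open>G\<close>, \<open>H\<close>, \<open>P\<close> are the
  increments of x, y and W under the action. Assumption \<open>H\<close> is the invariance of the
  cleared form of y_t, assumption \<open>P\<close> expands the increment of W, and \<open>Pc\<close>
  is its value under the automorphism.\<close>

lemma no_exponential_core:
  fixes q u u' x y c g W :: "'c::idom" and P H G :: "'c poly"
  assumes p: "prime p" "CHAR('c) = p" and d: "\<not> p dvd d" "d > 0"
    and q: "prime_elem q" and u: "u = q ^ e * u'" "\<not> q dvd u'" "e > 0" and y: "\<not> q dvd y"
    and W: "W = u ^ (p + 1) * x + y ^ (p * (p - 1)) + u ^ (p - 1) * y ^ (p * a + 1)"
    and H0: "poly H 0 = 0" and P0: "poly P 0 = 0"
    and H: "[:u:] ^ ((p + 1) * d) * H + ([:W:] + P) ^ d = [:W:] ^ d"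
    and P: "P = [:u:] ^ (p + 1) * G + (([:y:] + H) ^ (p * (p - 1)) - [:y:] ^ (p * (p - 1)))
              + [:u:] ^ (p - 1) * (([:y:] + H) ^ (p * a + 1) - [:y:] ^ (p * a + 1))"
    and Pc: "poly P c = u ^ ((p + 1) * d + 1) * (1 + u * g)"
  shows False
proof -
  let ?q = "[:q:]" and ?u = "[:u:]" and ?u' = "[:u':]" and ?y = "[:y:]" and ?N = "(p + 1) * d"
  have p2: "p \<ge> 2" using p(1) by (rule prime_ge_2_nat)
  have q': "prime_elem ?q" using q by (rule lift_prime_elem_poly)
  have q0: "?q \<noteq> 0" "q \<noteq> 0" using q by auto
  have q1: "\<not> q dvd 1" using q by (simp add: prime_elem_def)
  have qpow: "\<not> q dvd z ^ n" if "\<not> q dvd z" for z n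
    using that q prime_elem_dvd_power by blast
  have qmult: "\<not> q dvd z * w" if "\<not> q dvd z" "\<not> q dvd w" for z w
    using that q by (simp add: prime_elem_dvd_mult_iff)
  have uu: "?u = ?q ^ e * ?u'" by (simp add: u(1) poly_const_pow)
  have qu: "q dvd u" using u(1,3) by (simp add: dvd_mult2 dvd_power)
  \<comment> \<open>Modulo \<open>q\<close> only \<open>y ^ (p * (p - 1))\<close> survives in
    \<open>W\<close>, because \<open>p - 1 > 0\<close>.\<close>
  have qW: "\<not> q dvd W"
  proof
    assume "q dvd W"
    moreover have "q dvd u ^ (p + 1) * x + u ^ (p - 1) * y ^ (p * a + 1)"
      using qu p2 by (intro dvd_add dvd_mult2) (auto intro: dvd_trans[OF _ dvd_power])
    ultimately have "q dvd W - (u ^ (p + 1) * x + u ^ (p - 1) * y ^ (p * a + 1))" by (rule dvd_diff)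
    then show False using qpow[OF y] by (simp add: W)
  qed
  have CHARp: "CHAR('c poly) = p" using p(2) by simp
  have qd: "\<not> q dvd of_nat n" if "\<not> p dvd n" for n
    using of_nat_unit_mod_CHAR[OF p that] q1 dvd_trans by blast

  \<comment> \<open>The cofactor of \<open>P\<close> in \<open>([:W:] + P) ^ d - [:W:] ^ d\<close>.
    Its value \<open>d * W ^ (d - 1)\<close> at T = 0 is not divisible by \<open>q\<close>, so it
    can be cancelled whenever powers of \<open>q\<close> are compared.\<close>
  define M where "M = (\<Sum>i<d. [:W:] ^ (d - Suc i) * ([:W:] + P) ^ i)"
  have PM: "?u ^ ?N * H = - (P * M)"
  proof -
    have "([:W:] + P) ^ d - [:W:] ^ d = P * M"
      by (subst power_diff_sumr2) (simp add: M_def)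
    then show ?thesis using H by (simp add: eq_neg_iff_add_eq_0 algebra_simps)
  qed
  have "poly M 0 = (\<Sum>i<d. W ^ (d - 1))"
    unfolding M_def poly_sum
    by (rule sum.cong) (auto simp: P0 simp flip: power_add)
  then have qM: "\<not> ?q dvd M"
    using const_poly_dvd_imp_dvd_poly[of q M 0] qmult[OF qd[OF d(1)] qpow[OF qW]] by auto
  have "?q ^ (e * ?N) dvd P * M"
  proof -
    have "?q ^ (e * ?N) dvd ?u ^ ?N" unfolding uu power_mult_distrib power_mult[symmetric] by simp
    then have "?q ^ (e * ?N) dvd ?u ^ ?N * H" by (rule dvd_mult2)
    then show ?thesis unfolding PM by simp
  qed
  then have "?q ^ (e * ?N) dvd P" by (rule prime_elem_power_dvd_mult_cancel[OF q' qM])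
  then obtain P' where P': "P = ?q ^ (e * ?N) * P'" by (elim dvdE)
  have "?q ^ (e * ?N) * (?u' ^ ?N * H) = ?q ^ (e * ?N) * (- (P' * M))"
    using PM unfolding uu P' power_mult_distrib power_mult[symmetric] by (simp add: mult_ac)
  then have P'M: "?u' ^ ?N * H = - (P' * M)"
    using mult_left_cancel[OF power_not_zero[OF q0(1)]] by blast
  \<comment> \<open>Otherwise \<open>q\<close> would divide \<open>poly P c\<close> at least
    \<open>e * ?N + e + 1\<close> times, whereas \<open>Pc\<close> contains it exactly
    \<open>e * (?N + 1)\<close> times, since \<open>1 + u * g\<close> is 1 modulo
    \<open>q\<close>.\<close>
  have nH: "\<not> ?q ^ (e + 1) dvd H"
  proof
    assume "?q ^ (e + 1) dvd H"
    then have "?q ^ (e + 1) dvd - (P' * M)" unfolding P'M[symmetric] by (rule dvd_mult)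
    then have "?q ^ (e + 1) dvd P' * M" by (simp only: dvd_minus_iff)
    then have "?q ^ (e + 1) dvd P'" by (rule prime_elem_power_dvd_mult_cancel[OF q' qM])
    then obtain P'' where P'': "P' = ?q ^ (e + 1) * P''" by (elim dvdE)
    have "q ^ (e * ?N + e) * (u' ^ (?N + 1) * (1 + u * g)) = poly P c"
      unfolding Pc by (subst (2) u(1)) (simp add: power_mult_distrib power_add power_mult mult_ac)
    also have "\<dots> = q ^ (e * ?N + e) * (q * poly P'' c)"
      unfolding P' P'' by (simp add: power_add mult_ac)
    finally have "u' ^ (?N + 1) * (1 + u * g) = q * poly P'' c"
      using mult_left_cancel[OF power_not_zero[OF q0(2)]] by blast
    then have "q dvd u' ^ (?N + 1) * (1 + u * g)" by simp
    then have "q dvd 1 + u * g" using qmult qpow u(2) by blast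
    then have "q dvd 1" using dvd_diff[of q "1 + u * g" "u * g"] qu by simp
    then show False using q1 by simp
  qed
  obtain n where n: "?q ^ n dvd H" "\<not> ?q ^ Suc n dvd H"
    using ex_least_nat_less[of "\<lambda>m. \<not> ?q ^ m dvd H" "e + 1"] nH by auto
  have ne: "n \<le> e"
  proof (rule ccontr)
    assume "\<not> n \<le> e"
    then have "?q ^ (e + 1) dvd ?q ^ n" by (intro le_imp_power_dvd) simp
    then show False using nH n(1) dvd_trans by blast
  qed
  obtain H' where H': "H = ?q ^ n * H'" using n(1) by (elim dvdE)
  have qH': "\<not> ?q dvd H'"
  proof
    assume "?q dvd H'"
    then have "?q ^ n * ?q dvd ?q ^ n * H'" by (intro mult_dvd_mono) auto
    then show False using n(2) H' by (simp add: mult_ac)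
  qed
  have H'0: "poly H' 0 = 0" using H0 q0 by (simp add: H')
  define N1 where "N1 = pow_quot p (p - 1) ?y H"
  define N2 where "N2 = (?y + H) * pow_quot p a ?y H"
  \<comment> \<open>What is left of \<open>P - [:u:] ^ (p + 1) * G\<close> after removing
    \<open>?q ^ (n * p) * H'\<close>. The factor \<open>?q ^ ((e - n) * (p - 1))\<close> is the
    surplus of \<open>[:u:] ^ (p - 1) * H\<close> over \<open>H ^ p\<close>.\<close>
  define B where "B = H' ^ (p - 1) * N1 + ?q ^ ((e - n) * (p - 1)) * ?u' ^ (p - 1) * (?y ^ (p * a) + H ^ (p - 1) * N2)"
  have Hp: "F ^ p = F * F ^ (p - 1)" for F :: "'c poly"
    using p2 by (cases p) auto
  have "?q ^ (e * (p + 1)) dvd P - ?u ^ (p + 1) * G"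
  proof (rule dvd_diff)
    have "e * (p + 1) \<le> e * ?N"
      using mult_le_mono2[of 1 d "p + 1"] d(2) by (intro mult_le_mono2) simp
    then show "?q ^ (e * (p + 1)) dvd P" unfolding P' by (intro dvd_mult2 le_imp_power_dvd)
    have "?q ^ (e * (p + 1)) dvd ?u ^ (p + 1)"
      unfolding uu power_mult_distrib power_mult[symmetric] by (rule dvd_triv_left)
    then show "?q ^ (e * (p + 1)) dvd ?u ^ (p + 1) * G" by (rule dvd_mult2)
  qed
  also have "P - ?u ^ (p + 1) * G = H ^ p * N1 + ?u ^ (p - 1) * (?y ^ (p * a) * H + H ^ p * N2)"
    by (subst P) (simp only: pow_char_mult_diff[OF p(1) CHARp] pow_char_mult_Suc_diff[OF p(1) CHARp]
      N1_def N2_def add.assoc add_diff_cancel_left')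
  also have "\<dots> = ?q ^ (n * p) * (H' * B)"
  proof -
    have 1: "H ^ p * N1 = ?q ^ (n * p) * (H' * (H' ^ (p - 1) * N1))"
      by (simp add: H' power_mult_distrib power_mult Hp[of H'] mult_ac)
    have "e * (p - 1) + n = n * p + (e - n) * (p - 1)"
    proof -
      obtain k where "e = n + k" using ne le_Suc_ex by blast
      moreover obtain r where "p = r + 1" using p2 by (intro that[of "p - 1"]) simp
      ultimately show ?thesis by (simp add: algebra_simps)
    qed
    note E = this
    have qq: "(?q ^ e) ^ (p - 1) * ?q ^ n = ?q ^ (n * p) * ?q ^ ((e - n) * (p - 1))"
      by (simp only: power_mult[symmetric] power_add[symmetric] E)
    have "?u ^ (p - 1) * (?y ^ (p * a) * H + H ^ p * N2)
        = (?q ^ e) ^ (p - 1) * ?u' ^ (p - 1) * (H * (?y ^ (p * a) + H ^ (p - 1) * N2))"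
      unfolding uu power_mult_distrib Hp[of H] by (simp add: algebra_simps)
    also have "\<dots> = ((?q ^ e) ^ (p - 1) * ?q ^ n) * (?u' ^ (p - 1) * (H' * (?y ^ (p * a) + H ^ (p - 1) * N2)))"
      by (subst (1) H') (simp only: mult_ac)
    finally have 2: "?u ^ (p - 1) * (?y ^ (p * a) * H + H ^ p * N2) =
        ?q ^ (n * p) * (H' * (?q ^ ((e - n) * (p - 1)) * ?u' ^ (p - 1) * (?y ^ (p * a) + H ^ (p - 1) * N2)))"
      unfolding qq by (simp only: mult_ac)
    show ?thesis unfolding 1 2 B_def by (simp only: distrib_left)
  qed
  finally have "?q ^ (e * (p + 1)) dvd ?q ^ (n * p) * (H' * B)" .
  \<comment> \<open>Since \<open>n \<le> e\<close> and \<open>e > 0\<close>, the exponent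
    \<open>e * (p + 1)\<close> exceeds \<open>n * p\<close>, leaving one factor \<open>q\<close>
    that must divide \<open>H' * B\<close>.\<close>
  moreover have "?q ^ (n * p) * ?q dvd ?q ^ (e * (p + 1))"
  proof -
    have "n * p \<le> e * p" using ne by simp
    then have "n * p + 1 \<le> e * p + e" using u(3) by linarith
    then have "n * p + 1 \<le> e * (p + 1)" by (simp only: distrib_left mult_1_right)
    then have "?q ^ (n * p + 1) dvd ?q ^ (e * (p + 1))" by (rule le_imp_power_dvd)
    then show ?thesis by (simp only: power_add power_one_right)
  qed
  ultimately have "?q ^ (n * p) * ?q dvd ?q ^ (n * p) * (H' * B)" using dvd_trans by blast
  then have "?q dvd H' * B"
    using power_not_zero[OF q0(1)] unfolding dvd_mult_cancel_left by blast
  then have qB: "?q dvd B" using q' qH' by (simp add: prime_elem_dvd_mult_iff)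
  show False
  \<comment> \<open>For \<open>n = e\<close> the first summand of \<open>B\<close> vanishes at T = 0
    and the second becomes \<open>u' ^ (p - 1) * y ^ (p * a)\<close>. For \<open>n < e\<close> the
    second is divisible by \<open>q\<close>, so \<open>q\<close> divides \<open>N1\<close>, whose
    value at T = 0 is \<open>of_nat (p - 1) * (y ^ p) ^ (p - 2)\<close>.\<close>
  proof (cases "n = e")
    case True
    have "poly B 0 = u' ^ (p - 1) * y ^ (p * a)"
      using p2 by (simp add: B_def True H'0 H0 zero_power)
    then show False
      using const_poly_dvd_imp_dvd_poly[OF qB, of 0] qmult[OF qpow[OF u(2)] qpow[OF y]] by simp
  next
    case False
    then have "(e - n) * (p - 1) > 0" using ne p2 by simp
    then have "?q dvd ?q ^ ((e - n) * (p - 1))" by (simp add: dvd_power)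
    then have D: "?q dvd ?q ^ ((e - n) * (p - 1)) * ?u' ^ (p - 1) * (?y ^ (p * a) + H ^ (p - 1) * N2)"
      by (intro dvd_mult2)
    have "?q dvd H' ^ (p - 1) * N1" using qB unfolding B_def dvd_add_left_iff[OF D] .
    moreover have "\<not> ?q dvd H' ^ (p - 1)" using q' qH' prime_elem_dvd_power by blast
    ultimately have "?q dvd N1" using q' by (simp only: prime_elem_dvd_mult_iff) blast
    then have "q dvd poly N1 0" by (rule const_poly_dvd_imp_dvd_poly)
    also have "poly N1 0 = of_nat (p - 1) * (y ^ p) ^ (p - 1 - 1)"
      using p2 by (simp add: N1_def poly_pow_quot H0 pow_quot_0)
    finally have "q dvd of_nat (p - 1) * (y ^ p) ^ (p - 1 - 1)" .
    moreover have "\<not> p dvd p - 1" using p2 by (auto dest: dvd_imp_le)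
    ultimately show False using qmult[OF qd qpow[OF qpow[OF y]]] by blast
  qed
qed

section \<open>Subrings and additive group actions on them\<close>

lemma is_subring_adjoin: "is_subring (adjoin S V)"
  unfolding adjoin_def by (rule hull_in) (auto simp: is_subring_def)

lemma adjoin_superset: "S \<union> V \<subseteq> adjoin S V"
  unfolding adjoin_def by (rule hull_subset)

lemma adjoin_minimal: "is_subring T \<Longrightarrow> S \<subseteq> T \<Longrightarrow> V \<subseteq> T \<Longrightarrow> adjoin S V \<subseteq> T"
  unfolding adjoin_def by (rule hull_minimal) auto

section \<open>Closure properties of subrings and homomorphisms on them\<close>

context
  fixes B :: "'a::comm_ring_1 set"
  assumes B: "is_subring B"
begin

lemma subring_one: "1 \<in> B" and subring_diff: "a \<in> B \<Longrightarrow> b \<in> B \<Longrightarrow> a - b \<in> B"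
  and subring_mult: "a \<in> B \<Longrightarrow> b \<in> B \<Longrightarrow> a * b \<in> B"
  using B by (auto simp: is_subring_def)

lemma subring_zero: "0 \<in> B"
  using subring_diff[OF subring_one subring_one] by simp

lemma subring_uminus: "a \<in> B \<Longrightarrow> - a \<in> B"
  using subring_diff[OF subring_zero] by simp

lemma subring_add: "a \<in> B \<Longrightarrow> b \<in> B \<Longrightarrow> a + b \<in> B"
  using subring_diff[OF _ subring_uminus] by simp

lemma subring_power: "a \<in> B \<Longrightarrow> a ^ n \<in> B"
  by (induction n) (auto intro: subring_one subring_mult)

lemma subring_sum: "(\<And>i. i \<in> I \<Longrightarrow> F i \<in> B) \<Longrightarrow> sum F I \<in> B"
  by (induction I rule: infinite_finite_induct) (auto intro: subring_zero subring_add)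

lemma subring_of_nat: "of_nat n \<in> B"
  by (induction n) (auto intro: subring_zero subring_one subring_add)

lemmas subring_intros = subring_one subring_diff subring_mult subring_zero subring_uminus
  subring_add subring_power subring_sum subring_of_nat

lemma subring_polys_over: "is_subring (polys_over B)"
  unfolding is_subring_def polys_over_def
  by (auto simp: coeff_mult intro!: subring_intros)

lemma poly_in_subring: "q \<in> polys_over B \<Longrightarrow> c \<in> B \<Longrightarrow> poly q c \<in> B"
  by (auto simp: poly_altdef polys_over_def intro!: subring_intros)

context
  fixes \<phi> :: "'a \<Rightarrow> 'b::comm_ring_1"
  assumes hom: "ring_hom_on B \<phi>"
begin

lemma hom_one: "\<phi> 1 = 1" and hom_add: "a \<in> B \<Longrightarrow> b \<in> B \<Longrightarrow> \<phi> (a + b) = \<phi> a + \<phi> b"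
  and hom_mult: "a \<in> B \<Longrightarrow> b \<in> B \<Longrightarrow> \<phi> (a * b) = \<phi> a * \<phi> b"
  using hom by (auto simp: ring_hom_on_def)

lemma hom_zero: "\<phi> 0 = 0"
  using hom_add[OF subring_zero subring_zero] by simp

lemma hom_uminus: "a \<in> B \<Longrightarrow> \<phi> (- a) = - \<phi> a"
  using hom_add[of a "- a"] by (simp add: subring_uminus hom_zero eq_neg_iff_add_eq_0 add.commute)

lemma hom_diff: "a \<in> B \<Longrightarrow> b \<in> B \<Longrightarrow> \<phi> (a - b) = \<phi> a - \<phi> b"
  using hom_add[of a "- b"] by (simp add: subring_uminus hom_uminus)

lemma hom_power: "a \<in> B \<Longrightarrow> \<phi> (a ^ n) = \<phi> a ^ n"
  by (induction n) (auto simp: hom_one hom_mult subring_power)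

lemma hom_sum: "(\<And>i. i \<in> I \<Longrightarrow> F i \<in> B) \<Longrightarrow> \<phi> (sum F I) = (\<Sum>i\<in>I. \<phi> (F i))"
  by (induction I rule: infinite_finite_induct) (auto simp: hom_zero hom_add subring_sum)

lemma subring_vimage: "is_subring T \<Longrightarrow> is_subring {b \<in> B. \<phi> b \<in> T}"
  unfolding is_subring_def by (auto simp: hom_one hom_mult hom_diff subring_one subring_diff subring_mult)

lemma hom_of_nat: "\<phi> (of_nat n) = of_nat n"
  by (induction n) (auto simp: hom_zero hom_one hom_add subring_one subring_of_nat)

lemma hom_poly:
  assumes "q \<in> polys_over B" "c \<in> B"
  shows "\<phi> (poly q c) = (\<Sum>i\<le>degree q. \<phi> (coeff q i) * \<phi> c ^ i)"
proof -
  have q: "coeff q i \<in> B" for i using assms(1) by (simp add: polys_over_def)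
  show ?thesis
    unfolding poly_altdef
    by (subst hom_sum) (auto simp: q assms(2) hom_mult hom_power subring_mult subring_power)
qed

lemma hom_map_poly: "ring_hom_on (polys_over B) (map_poly \<phi>)"
  unfolding ring_hom_on_def
proof (intro conjI ballI)
  show "map_poly \<phi> 1 = 1" by (rule poly_eqI) (simp add: coeff_map_poly hom_zero hom_one)
  fix r q assume "r \<in> polys_over B" "q \<in> polys_over B"
  then have c: "coeff r i \<in> B" "coeff q i \<in> B" for i by (auto simp: polys_over_def)
  show "map_poly \<phi> (r + q) = map_poly \<phi> r + map_poly \<phi> q"
    by (rule poly_eqI) (simp add: coeff_map_poly hom_zero hom_add c)
  show "map_poly \<phi> (r * q) = map_poly \<phi> r * map_poly \<phi> q"
    by (rule poly_eqI) (simp add: coeff_map_poly hom_zero hom_sum hom_mult c coeff_mult subring_mult)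
qed

end

text \<open>The equalizer of two homomorphisms. With \<open>adjoin_minimal\<close> it reduces an
  identity on an adjoined ring to its generators.\<close>

lemma subring_eqs:
  fixes \<phi> \<psi> :: "'a \<Rightarrow> 'b::comm_ring_1"
  assumes "ring_hom_on B \<phi>" "ring_hom_on B \<psi>"
  shows "is_subring {b \<in> B. \<phi> b = \<psi> b}"
  unfolding is_subring_def
  by (auto simp: hom_one[OF assms(1)] hom_one[OF assms(2)] hom_mult[OF assms(1)] hom_mult[OF assms(2)]
      hom_diff[OF assms(1)] hom_diff[OF assms(2)] subring_one subring_diff subring_mult)

end

lemma ring_hom_on_comp:
  assumes "ring_hom_on B \<phi>" "ring_hom_on C \<psi>" "\<phi> ` B \<subseteq> C"
  shows "ring_hom_on B (\<lambda>b. \<psi> (\<phi> b))"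
  using assms unfolding ring_hom_on_def by (auto simp: image_subset_iff)

lemma ring_hom_on_subset: "ring_hom_on B \<phi> \<Longrightarrow> A \<subseteq> B \<Longrightarrow> ring_hom_on A \<phi>"
  unfolding ring_hom_on_def by (simp add: subset_iff)

lemma coeff_X_pow: "coeff ([:0, 1::'a::comm_semiring_1:] ^ i) m = (if m = i then 1 else 0)"
  using coeff_monom[of "1::'a" i m] by (auto simp: monom_altdef)

lemma coeff_linear_monic_power:
  "coeff ([:a, 1::'a::comm_ring_1:] ^ n) i = of_nat (n choose i) * a ^ (n - i)"
proof (cases "i \<le> n")
  case False
  then have "degree ([:a, 1:] ^ n) < i"
    using degree_power_le[of "[:a, 1:]" n] by simp
  with False show ?thesis by (simp add: coeff_eq_0 binomial_eq_0)
qed (simp add: coeff_linear_poly_power)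

text \<open>
  Coefficientwise, a \<open>G\<^sub>a\<close>-action is a locally finite iterative higher derivation.
\<close>

lemma Ga_action_iff:
  fixes B :: "'a::idom set"
  assumes B: "is_subring B"
  shows "Ga_action B E \<longleftrightarrow> ring_hom_on B E \<and> (\<forall>b\<in>B. \<forall>i. coeff (E b) i \<in> B) \<and>
    (\<forall>b\<in>B. coeff (E b) 0 = b) \<and>
    (\<forall>b\<in>B. \<forall>i j. coeff (E (coeff (E b) i)) j = of_nat ((i + j) choose i) * coeff (E b) (i + j))"
proof (cases "ring_hom_on B E")
  case True
  have E0: "E 0 = 0" by (rule hom_zero[OF B True])
  \<comment> \<open>Both sides of (A2) are compared at T1^j T2^m. Truncation at the degree loses
    nothing, since later coefficients are zero and \<open>E 0 = 0\<close>; on the right only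
    \<open>i = m + j\<close> contributes.\<close>
  have 1: "coeff (\<Sum>i\<le>degree (E b). [:E (coeff (E b) i):] * [:0, 1:] ^ i) m = E (coeff (E b) m)" for b m
  proof -
    have t: "coeff ([:F:] * [:0, 1:] ^ i) m = (if i = m then F else 0)" for F :: "'a poly" and i
      by (simp add: coeff_X_pow)
    show ?thesis
      unfolding coeff_sum t by (auto simp: sum.delta coeff_eq_0 E0)
  qed
  have 2: "coeff (coeff (\<Sum>i\<le>degree (E b). [:[:coeff (E b) i:]:] * ([:[:0, 1:]:] + [:0, 1:]) ^ i) m) j
      = of_nat ((m + j) choose m) * coeff (E b) (m + j)" for b m j
  proof -
    have t: "coeff (coeff ([:[:c:]:] * ([:[:0, 1:]:] + [:0, 1:]) ^ i) m) j
        = (if i = m + j then of_nat ((m + j) choose m) * c else 0)" for c :: 'a and i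
    proof -
      have "[:[:c:]:] * ([:[:0, 1:]:] + [:0, 1:]) ^ i = smult [:c:] ([:[:0, 1:], 1:] ^ i)" by simp
      moreover have "coeff (of_nat (i choose m) * [:0, 1::'a:] ^ (i - m)) j
          = of_nat (i choose m) * coeff ([:0, 1:] ^ (i - m)) j"
        by (simp add: of_nat_poly)
      ultimately show ?thesis
        by (cases "m \<le> i") (auto simp: coeff_linear_monic_power coeff_X_pow binomial_eq_0)
    qed
    show ?thesis
      unfolding coeff_sum t by (auto simp: sum.delta coeff_eq_0)
  qed
  show ?thesis
    unfolding Ga_action_def poly_eq_iff[where 'a = "'a poly"] 1
    unfolding poly_eq_iff[where 'a = 'a] 2
    using True by (auto simp: polys_over_def image_subset_iff poly_0_coeff_0)
qed (simp add: Ga_action_def)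

section \<open>Rescaling, transport and localization of additive group actions\<close>

context
  fixes B :: "'a::idom set" and E :: "'a \<Rightarrow> 'a poly"
  assumes B: "is_subring B" and E: "Ga_action B E"
begin

lemma Ga_hom: "ring_hom_on B E" and Ga_coeff: "b \<in> B \<Longrightarrow> coeff (E b) i \<in> B"
  and Ga_coeff_0: "b \<in> B \<Longrightarrow> coeff (E b) 0 = b"
  and Ga_coeff_coeff:
    "b \<in> B \<Longrightarrow> coeff (E (coeff (E b) i)) j = of_nat ((i + j) choose i) * coeff (E b) (i + j)"
  using E unfolding Ga_action_iff[OF B] by auto

lemma Ga_invariant_mult: "r \<in> invariant_ring B E \<Longrightarrow> b \<in> B \<Longrightarrow> E (r * b) = smult r (E b)"
  by (auto simp: invariant_ring_def hom_mult[OF B Ga_hom])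

lemma subring_invariant_ring: "is_subring (invariant_ring B E)"
  unfolding is_subring_def invariant_ring_def
  by (auto simp: hom_mult[OF B Ga_hom] hom_diff[OF B Ga_hom] hom_one[OF B Ga_hom]
      subring_intros[OF B] one_pCons)

text \<open>Turns the value at T = c into the value at T = 1, the form used by stability.
  Coefficient \<open>i\<close> is multiplied by \<open>c ^ i\<close>, which passes through
  \<open>E\<close> because \<open>c\<close> is invariant, so the iteration rule survives.\<close>

lemma Ga_action_scale:
  assumes c: "c \<in> invariant_ring B E"
  shows "Ga_action B (\<lambda>b. pcompose (E b) [:0, c:])"
  unfolding Ga_action_iff[OF B] ring_hom_on_def
proof (intro conjI ballI allI)
  have cB: "c \<in> B" using c by (simp add: invariant_ring_def)
  show "pcompose (E 1) [:0, c:] = 1" by (simp add: hom_one[OF B Ga_hom] one_pCons)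
  fix a assume a: "a \<in> B"
  show "coeff (pcompose (E a) [:0, c:]) i \<in> B" for i
    by (simp add: coeff_pcompose_linear Ga_coeff a cB subring_intros[OF B])
  show "coeff (pcompose (E a) [:0, c:]) 0 = a"
    by (simp only: coeff_pcompose_linear Ga_coeff_0[OF a] power_0 mult_1_left)
  show "coeff (pcompose (E (coeff (pcompose (E a) [:0, c:]) i)) [:0, c:]) j
      = of_nat ((i + j) choose i) * coeff (pcompose (E a) [:0, c:]) (i + j)" for i j
    using Ga_invariant_mult[OF subring_power[OF subring_invariant_ring c], of "coeff (E a) i"] a
    by (simp add: coeff_pcompose_linear Ga_coeff Ga_coeff_coeff power_add mult_ac)
  fix b assume b: "b \<in> B"
  show "pcompose (E (a + b)) [:0, c:] = pcompose (E a) [:0, c:] + pcompose (E b) [:0, c:]"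
    by (simp add: hom_add[OF B Ga_hom] a b pcompose_add)
  show "pcompose (E (a * b)) [:0, c:] = pcompose (E a) [:0, c:] * pcompose (E b) [:0, c:]"
    by (simp add: hom_mult[OF B Ga_hom] a b pcompose_mult)
qed

text \<open>Conjugation by an isomorphism \<open>\<theta>\<close> with inverse
  \<open>\<phi>\<close>; the two maps need to be mutually inverse only on the subrings.\<close>

lemma Ga_action_transport:
  fixes \<theta> :: "'a \<Rightarrow> 'b::idom" and \<phi> :: "'b \<Rightarrow> 'a"
  assumes B2: "is_subring B2" and \<theta>: "ring_hom_on B \<theta>" "\<theta> ` B \<subseteq> B2" and \<phi>: "ring_hom_on B2 \<phi>" "\<phi> ` B2 \<subseteq> B"
    and inv: "\<And>b. b \<in> B \<Longrightarrow> \<phi> (\<theta> b) = b" "\<And>q. q \<in> B2 \<Longrightarrow> \<theta> (\<phi> q) = q"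
  shows "Ga_action B2 (\<lambda>q. map_poly \<theta> (E (\<phi> q)))"
  unfolding Ga_action_iff[OF B2]
proof (intro conjI ballI allI)
  have \<theta>0: "\<theta> 0 = 0" by (rule hom_zero[OF B \<theta>(1)])
  have cB: "coeff (E b) i \<in> B" if "b \<in> B" for b i using that by (rule Ga_coeff)
  have "ring_hom_on B2 (\<lambda>q. E (\<phi> q))"
    by (rule ring_hom_on_comp[OF \<phi>(1) Ga_hom \<phi>(2)])
  then show "ring_hom_on B2 (\<lambda>q. map_poly \<theta> (E (\<phi> q)))"
    by (rule ring_hom_on_comp[OF _ hom_map_poly[OF B \<theta>(1)]])
      (use \<phi>(2) cB in \<open>auto simp: polys_over_def\<close>)
  fix q assume q: "q \<in> B2"
  then have \<phi>q: "\<phi> q \<in> B" using \<phi>(2) by auto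
  show "coeff (map_poly \<theta> (E (\<phi> q))) i \<in> B2" for i
    using \<theta>(2) cB[OF \<phi>q] by (auto simp: coeff_map_poly \<theta>0)
  show "coeff (map_poly \<theta> (E (\<phi> q))) 0 = q"
    using \<phi>q q inv by (simp add: coeff_map_poly \<theta>0 Ga_coeff_0)
  show "coeff (map_poly \<theta> (E (\<phi> (coeff (map_poly \<theta> (E (\<phi> q))) i)))) j =
    of_nat ((i + j) choose i) * coeff (map_poly \<theta> (E (\<phi> q))) (i + j)" for i j
    by (simp add: coeff_map_poly \<theta>0 inv cB[OF \<phi>q] Ga_coeff_coeff[OF \<phi>q]
        hom_mult[OF B \<theta>(1)] hom_of_nat[OF B \<theta>(1)] subring_of_nat[OF B])
qed

text \<open>Every \<open>b\<close> in \<open>B'\<close> has an invariant denominator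
  \<open>r\<close> with inverse \<open>s\<close> in \<open>B'\<close>, and linearity over invariants
  forces the value \<open>smult s (E (r * b))\<close>.\<close>

lemma Ga_action_localize:
  assumes B': "is_subring B'" "B \<subseteq> B'"
    and den: "\<And>b. b \<in> B' \<Longrightarrow> \<exists>r\<in>invariant_ring B E. \<exists>s\<in>B'. s * r = 1 \<and> r * b \<in> B"
  obtains E1 where "Ga_action B' E1"
    and "\<And>b r s. b \<in> B' \<Longrightarrow> r \<in> invariant_ring B E \<Longrightarrow> s * r = 1 \<Longrightarrow> r * b \<in> B \<Longrightarrow> E1 b = smult s (E (r * b))"
proof
  define ok where "ok b = (\<lambda>(r, s). r \<in> invariant_ring B E \<and> s \<in> B' \<and> s * r = 1 \<and> r * b \<in> B)" for b
  define E1 where "E1 b = (case (SOME rs. ok b rs) of (r, s) \<Rightarrow> smult s (E (r * b)))" for b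
  \<comment> \<open>Independence of the chosen denominator: cross-multiply, then multiply by both
    inverses.\<close>
  have uniq: "smult s (E (r * b)) = smult s' (E (r' * b))"
    if r: "r \<in> invariant_ring B E" "s * r = 1" "r * b \<in> B"
      and r': "r' \<in> invariant_ring B E" "s' * r' = 1" "r' * b \<in> B" for r s r' s' b
  proof -
    have "smult r' (E (r * b)) = smult r (E (r' * b))"
      using Ga_invariant_mult[OF r'(1) r(3)] Ga_invariant_mult[OF r(1) r'(3)] by (simp add: mult_ac)
    then have "smult (s * s') (smult r' (E (r * b))) = smult (s * s') (smult r (E (r' * b)))" by simp
    then have "smult (s * (s' * r')) (E (r * b)) = smult (s' * (s * r)) (E (r' * b))"
      by (simp add: mult_ac)
    then show ?thesis using r(2) r'(2) by simp
  qed
  show E1: "E1 b = smult s (E (r * b))"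
    if b: "b \<in> B'" and r: "r \<in> invariant_ring B E" "s * r = 1" "r * b \<in> B" for b r s
  proof -
    have "\<exists>rs. ok b rs" using den[OF b] by (auto simp: ok_def)
    then have "ok b (SOME rs. ok b rs)" by (rule someI_ex)
    then show ?thesis unfolding E1_def using uniq[OF _ _ _ r] by (auto simp: ok_def split: prod.splits)
  qed
  show "Ga_action B' E1"
    unfolding Ga_action_iff[OF B'(1)] ring_hom_on_def
  proof (intro conjI ballI allI)
    have inv1: "1 \<in> invariant_ring B E" by (rule subring_one[OF subring_invariant_ring])
    show "E1 1 = 1"
      using E1[OF subring_one[OF B'(1)] inv1, of 1] by (simp add: subring_one[OF B] hom_one[OF B Ga_hom])
    fix a assume a: "a \<in> B'"
    then obtain r s where r: "r \<in> invariant_ring B E" "s \<in> B'" "s * r = 1" "r * a \<in> B" using den by blast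
    have rB: "r \<in> B" using r(1) by (simp add: invariant_ring_def)
    have Ea: "E1 a = smult s (E (r * a))" using E1 a r by blast
    show aB: "coeff (E1 a) i \<in> B'" for i
      unfolding Ea using Ga_coeff[OF r(4), of i] B'(2) by (auto intro!: subring_mult[OF B'(1)] r)
    show "coeff (E1 a) 0 = a"
      unfolding Ea using r(3) by (simp add: Ga_coeff_0[OF r(4)] flip: mult.assoc)
    show "coeff (E1 (coeff (E1 a) i)) j = of_nat ((i + j) choose i) * coeff (E1 a) (i + j)" for i j
    proof -
      have rc: "r * coeff (E1 a) i = coeff (E (r * a)) i"
        using r(3) by (simp add: Ea mult.commute[of r] flip: mult.assoc)
      have "E1 (coeff (E1 a) i) = smult s (E (coeff (E (r * a)) i))"
        using E1[OF aB[of i] r(1) r(3)] unfolding rc using Ga_coeff[OF r(4)] by blast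
      then show ?thesis unfolding Ea by (simp add: Ga_coeff_coeff[OF r(4)] mult.left_commute)
    qed
    fix b assume b: "b \<in> B'"
    then obtain r' s' where r': "r' \<in> invariant_ring B E" "s' \<in> B'" "s' * r' = 1" "r' * b \<in> B" using den by blast
    have r'B: "r' \<in> B" using r'(1) by (simp add: invariant_ring_def)
    have Eb: "E1 b = smult s' (E (r' * b))" using E1 b r' by blast
    \<comment> \<open>\<open>r * r'\<close> serves as a common denominator for the sum and for the
      product.\<close>
    have rr: "r * r' \<in> invariant_ring B E" using r(1) r'(1) by (rule subring_mult[OF subring_invariant_ring])
    have ss: "(s * s') * (r * r') = 1" using r(3) r'(3) by (metis mult.commute mult.left_commute mult_1)
    have eqs: "r * r' * (a + b) = r' * (r * a) + r * (r' * b)" "r * r' * (a * b) = (r * a) * (r' * b)"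
      by (simp_all add: algebra_simps)
    have "E1 (a + b) = smult (s * s') (E (r' * (r * a) + r * (r' * b)))"
      using E1[OF subring_add[OF B'(1) a b] rr ss] unfolding eqs
      using r r' rB r'B by (blast intro: subring_add[OF B] subring_mult[OF B])
    also have "E (r' * (r * a) + r * (r' * b)) = smult r' (E (r * a)) + smult r (E (r' * b))"
      using hom_add[OF B Ga_hom subring_mult[OF B r'B r(4)] subring_mult[OF B rB r'(4)]]
        Ga_invariant_mult[OF r'(1) r(4)] Ga_invariant_mult[OF r(1) r'(4)] by simp
    also have "smult (s * s') (smult r' X + smult r Y) = smult (s * (s' * r')) X + smult (s' * (s * r)) Y" for X Y
      by (simp add: smult_add_right mult_ac)
    finally show "E1 (a + b) = E1 a + E1 b" using r(3) r'(3) by (simp add: Ea Eb)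
    have "E1 (a * b) = smult (s * s') (E ((r * a) * (r' * b)))"
      using E1[OF subring_mult[OF B'(1) a b] rr ss] unfolding eqs
      using r r' by (blast intro: subring_mult[OF B])
    then show "E1 (a * b) = E1 a * E1 b"
      using r r' by (simp add: Ea Eb hom_mult[OF B Ga_hom] mult.commute[of s])
  qed
qed

end

section \<open>Congruences in a subring\<close>

lemma CHAR_inj_hom:
  fixes h :: "'a::comm_ring_1 \<Rightarrow> 'b::comm_ring_1"
  assumes h: "ring_hom_on UNIV h" and inj: "inj h"
  shows "CHAR('b) = CHAR('a)"
proof (rule CHAR_eqI)
  have U: "is_subring (UNIV :: 'a set)" by (simp add: is_subring_def)
  have h0: "h 0 = 0" by (rule hom_zero[OF U h])
  have hn: "of_nat n = h (of_nat n)" for n by (rule hom_of_nat[OF U h, symmetric])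
  show "of_nat CHAR('a) = (0::'b)" unfolding hn by (simp add: h0)
  show "CHAR('a) dvd n" if "of_nat n = (0::'b)" for n
    using that unfolding hn using inj h0 by (metis injD of_nat_eq_0_iff_char_dvd)
qed

text \<open>The quotient must lie in \<open>B\<close>: in the application \<open>u\<close> is a unit
  of the ambient polynomial ring over the fraction field, where congruence modulo \<open>u\<close>
  would be empty of content.\<close>

definition cong_mod :: "'a::comm_ring_1 set \<Rightarrow> 'a \<Rightarrow> 'a \<Rightarrow> 'a \<Rightarrow> bool" where
  "cong_mod B u s t \<longleftrightarrow> s \<in> B \<and> t \<in> B \<and> (\<exists>r\<in>B. s - t = u * r)"

context
  fixes B :: "'a::comm_ring_1 set" and u :: 'a
  assumes B: "is_subring B"
begin

lemma cong_mod_refl: "s \<in> B \<Longrightarrow> cong_mod B u s s"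
  unfolding cong_mod_def using subring_zero[OF B] by force

lemma cong_mod_add: "cong_mod B u s t \<Longrightarrow> cong_mod B u s' t' \<Longrightarrow> cong_mod B u (s + s') (t + t')"
  unfolding cong_mod_def
  by (metis B subring_add add_diff_add distrib_left)

lemma cong_mod_mult:
  assumes "cong_mod B u s t" "cong_mod B u s' t'"
  shows "cong_mod B u (s * s') (t * t')"
proof -
  obtain r r' where r: "s - t = u * r" "s' - t' = u * r'" "r \<in> B" "r' \<in> B"
    using assms by (auto simp: cong_mod_def)
  have "s * s' - t * t' = (s - t) * t' + s * (s' - t')" by (simp add: algebra_simps)
  also have "\<dots> = u * (r * t' + s * r')" by (simp add: r algebra_simps)
  finally show ?thesis
    using assms r(3,4) unfolding cong_mod_def by (blast intro: subring_intros[OF B])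
qed

lemma cong_mod_uminus: "cong_mod B u s t \<Longrightarrow> cong_mod B u (- s) (- t)"
  using cong_mod_mult[OF cong_mod_refl[OF subring_uminus[OF B subring_one[OF B]]], of s t] by simp

lemma cong_mod_power: "cong_mod B u s t \<Longrightarrow> cong_mod B u (s ^ n) (t ^ n)"
  by (induction n) (simp_all add: cong_mod_mult cong_mod_refl subring_one[OF B])

lemma cong_mod_sum:
  "(\<And>i. i \<in> I \<Longrightarrow> cong_mod B u (F i) (F' i)) \<Longrightarrow> cong_mod B u (sum F I) (sum F' I)"
  by (induction I rule: infinite_finite_induct)
    (simp_all add: cong_mod_add cong_mod_refl subring_zero[OF B])

lemma cong_mod_mult_zero: "u \<in> B \<Longrightarrow> r \<in> B \<Longrightarrow> cong_mod B u (u * r) 0"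
  unfolding cong_mod_def by (auto intro: subring_intros[OF B])

end

text \<open>
  The exponent \<open>a\<close> is chosen so that the two terms of order \<open>u\<^sup>p\<close> in \<open>\<lambda>(y + H) - \<lambda>(y)\<close> cancel
  modulo \<open>u\<^sup>p\<^sup>+\<^sup>1\<close>.
\<close>

lemma perturbation_integral:
  fixes B :: "'a::idom set"
  assumes p: "prime p" "CHAR('a) = p" and B: "is_subring B"
    and mem: "u \<in> B" "x \<in> B" "y \<in> B" "g \<in> B" and u0: "u \<noteq> 0" and d: "d > 0"
    and a: "a = p - 2 + (p - 1)\<^sup>2 * (d - 1)"
    and W: "W = u ^ (p + 1) * x + y ^ (p * (p - 1)) + u ^ (p - 1) * y ^ (p * a + 1)"
    and Pdef: "P = u ^ ((p + 1) * d + 1) * (1 + u * g)"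
    and H: "u ^ ((p + 1) * d) * H + (W + P) ^ d = W ^ d"
    and P: "P = u ^ (p + 1) * G + ((y + H) ^ (p * (p - 1)) - y ^ (p * (p - 1)))
              + u ^ (p - 1) * ((y + H) ^ (p * a + 1) - y ^ (p * a + 1))"
  shows "H \<in> B" and "G \<in> B"
proof -
  note I = subring_intros[OF B]
  let ?f = "1 + u * g" and ?w = "y ^ (p * (p - 1))" and ?N = "(p + 1) * d"
  have p2: "p \<ge> 2" using p(1) by (rule prime_ge_2_nat)
  have c0: "cong_mod B u (u ^ n * r) 0" if "n > 0" "r \<in> B" for n r
  proof -
    have "u ^ n * r = u * (u ^ (n - 1) * r)" using that(1) by (cases n) (simp_all add: mult_ac)
    then show ?thesis using cong_mod_mult_zero[OF B mem(1)] that(2) mem(1) I by metis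
  qed
  have WB: "W \<in> B" and fB: "?f \<in> B" unfolding W by (intro I mem)+
  have PB: "P \<in> B" unfolding Pdef by (intro I mem)
  define M where "M = (\<Sum>i<d. W ^ (d - Suc i) * (W + P) ^ i)"
  have MB: "M \<in> B" unfolding M_def by (intro I WB PB)
  \<comment> \<open>The quotient of \<open>H\<close> by \<open>u\<close>: \<open>P\<close> carries
    one factor \<open>u\<close> more than \<open>u ^ ?N\<close>.\<close>
  define h where "h = - (?f * M)"
  have hB: "h \<in> B" unfolding h_def by (intro I mem MB)
  have "(W + P) ^ d - W ^ d = P * M" by (subst power_diff_sumr2) (simp add: M_def)
  then have "u ^ ?N * H = - (P * M)" using H by (simp add: eq_neg_iff_add_eq_0 algebra_simps)
  also have "\<dots> = u ^ ?N * (u * h)" unfolding Pdef h_def by (simp add: mult_ac)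
  finally have Hh: "H = u * h" using mult_left_cancel[OF power_not_zero[OF u0]] by blast
  show HB: "H \<in> B" unfolding Hh by (intro I mem hB)

  have cW: "cong_mod B u W ?w"
    using cong_mod_add[OF B cong_mod_add[OF B c0[of "p + 1" x] cong_mod_refl[OF B, of ?w]]
        c0[of "p - 1" "y ^ (p * a + 1)"]] p2 subring_power[OF B mem(3), of "p * a + 1"]
      subring_power[OF B mem(3), of "p * (p - 1)"] mem(2)
    unfolding W by simp
  have cWP: "cong_mod B u (W + P) ?w"
    using cong_mod_add[OF B cW c0[of "?N + 1" ?f]] fB by (simp add: Pdef)
  have "cong_mod B u M (\<Sum>i<d. ?w ^ (d - Suc i) * ?w ^ i)"
    unfolding M_def by (intro cong_mod_sum[OF B] cong_mod_mult[OF B] cong_mod_power[OF B] cW cWP)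
  also have "(\<Sum>i<d. ?w ^ (d - Suc i) * ?w ^ i) = (\<Sum>i<d. ?w ^ (d - 1))"
    by (rule sum.cong) (auto simp flip: power_add)
  finally have cM: "cong_mod B u M (of_nat d * ?w ^ (d - 1))" by simp
  have cf: "cong_mod B u ?f 1"
    using cong_mod_add[OF B cong_mod_refl[OF B subring_one[OF B]] cong_mod_mult_zero[OF B mem(1,4)]] by simp
  have ch: "cong_mod B u h (- (of_nat d * ?w ^ (d - 1)))"
    using cong_mod_uminus[OF B cong_mod_mult[OF B cf cM]] by (simp add: h_def)
  define N1 where "N1 = pow_quot p (p - 1) y H"
  define N2 where "N2 = (y + H) * pow_quot p a y H"
  have N2B: "N2 \<in> B" unfolding N2_def pow_quot_def by (intro I mem HB)
  have cH: "cong_mod B u H 0" unfolding Hh by (intro cong_mod_mult_zero[OF B] mem hB)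
  have "cong_mod B u N1 (pow_quot p (p - 1) y 0)"
    unfolding N1_def pow_quot_def
    by (intro cong_mod_sum[OF B] cong_mod_mult[OF B] cong_mod_power[OF B] cong_mod_add[OF B] cH cong_mod_refl[OF B] I mem)
  also have "pow_quot p (p - 1) y 0 = - (y ^ (p * (p - 2)))"
  proof -
    have "(of_nat (p - 1) :: 'a) = of_nat p - 1" using p2 by (subst of_nat_diff) auto
    also have "(of_nat p :: 'a) = 0" using p(2) of_nat_CHAR by metis
    finally have "(of_nat (p - 1) :: 'a) = - 1" by simp
    moreover have "p - 1 - 1 = p - 2" by simp
    ultimately show ?thesis using p2 by (simp only: pow_quot_0 power_mult) simp
  qed
  finally have cN1: "cong_mod B u N1 (- (y ^ (p * (p - 2))))" .
  have "cong_mod B u (h ^ p * N1 + y ^ (p * a) * h)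
    ((- (of_nat d * ?w ^ (d - 1))) ^ p * - (y ^ (p * (p - 2))) + y ^ (p * a) * - (of_nat d * ?w ^ (d - 1)))"
    by (intro cong_mod_add[OF B] cong_mod_mult[OF B] cong_mod_power[OF B] ch cN1 cong_mod_refl[OF B] I mem)
  \<comment> \<open>The cancellation modulo \<open>u\<close>. Frobenius gives the sign rule
    \<open>neg\<close> for \<open>p = 2\<close> as well, \<open>frob\<close> is Fermat's little
    theorem and makes both coefficients \<open>d\<close>, and the choice of \<open>a\<close> makes
    the powers of \<open>y\<close> agree.\<close>
  also have "(- (of_nat d * ?w ^ (d - 1))) ^ p * - (y ^ (p * (p - 2))) + y ^ (p * a) * - (of_nat d * ?w ^ (d - 1)) = 0"
  proof -
    have neg: "(- z) ^ p = - (z ^ p)" for z :: 'a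
    proof -
      have "0 = (z + - z) ^ p" using p2 by simp
      also have "\<dots> = z ^ p + (- z) ^ p" using p by (intro freshmans_dream) auto
      finally show ?thesis by (simp add: eq_neg_iff_add_eq_0 add.commute)
    qed
    have frob: "(of_nat n :: 'a) ^ p = of_nat n" for n
    proof (induction n)
      case 0
      then show ?case using p2 by simp
    next
      case (Suc n)
      have "(1 + of_nat n :: 'a) ^ p = 1 ^ p + of_nat n ^ p" using p by (intro freshmans_dream) auto
      then show ?case by (simp add: Suc)
    qed
    obtain r where r: "p = r + 2" using p2 by (metis add.commute le_Suc_ex)
    obtain m where m: "d = m + 1" using d by (metis Suc_eq_plus1 gr0_implies_Suc)
    have "(?w ^ (d - 1)) ^ p * y ^ (p * (p - 2)) = y ^ (p * (p - 1) * (d - 1) * p + p * (p - 2))"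
      by (simp only: power_mult power_add)
    also have "p * (p - 1) * (d - 1) * p + p * (p - 2) = p * a + p * (p - 1) * (d - 1)"
      unfolding a r m by (simp add: algebra_simps power2_eq_square)
    also have "y ^ (p * a + p * (p - 1) * (d - 1)) = y ^ (p * a) * ?w ^ (d - 1)"
      by (simp only: power_mult power_add)
    finally show ?thesis unfolding neg power_mult_distrib frob by (simp add: mult_ac)
  qed
  finally obtain r where r: "r \<in> B" "h ^ p * N1 + y ^ (p * a) * h = u * r"
    by (auto simp: cong_mod_def)
  \<comment> \<open>\<open>d > 0\<close> keeps the natural subtraction \<open>?N - p\<close> from
    truncating.\<close>
  have "?N - p + (p + 1) = ?N + 1"
  proof -
    have "p \<le> ?N" using d by (metis le_add1 le_trans mult.right_neutral mult_le_mono2 Suc_leI One_nat_def)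
    then show ?thesis by simp
  qed
  then have E1: "P = u ^ (p + 1) * (u ^ (?N - p) * ?f)"
    unfolding Pdef by (metis mult.assoc mult.commute power_add)
  have E2: "u ^ p * (u * r) = u ^ (p + 1) * r" by simp
  have E3: "u ^ (p - 1) * (u ^ p * (h ^ p * N2)) = u ^ (p + 1) * (u ^ (p - 2) * (h ^ p * N2))"
  proof -
    have "p - 1 + p = p + 1 + (p - 2)" using p2 by simp
    then show ?thesis by (metis mult.assoc power_add)
  qed
  have E4: "u ^ (p - 1) * (y ^ (p * a) * H) = u ^ p * (y ^ (p * a) * h)"
    using p2 unfolding Hh by (cases p) (simp_all add: mult_ac)
  \<comment> \<open>All terms are brought to the common factor \<open>u ^ (p + 1)\<close>;
    cancelling it expresses \<open>G\<close> through elements of \<open>B\<close>.\<close>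
  have "P = u ^ (p + 1) * G + H ^ p * N1 + u ^ (p - 1) * (y ^ (p * a) * H + H ^ p * N2)"
    by (subst P) (simp only: pow_char_mult_diff[OF p] pow_char_mult_Suc_diff[OF p] N1_def N2_def)
  also have "\<dots> = u ^ (p + 1) * G + u ^ p * (h ^ p * N1) + (u ^ (p - 1) * (y ^ (p * a) * H) + u ^ (p - 1) * (u ^ p * (h ^ p * N2)))"
    by (simp only: Hh power_mult_distrib distrib_left mult.assoc)
  also have "\<dots> = u ^ (p + 1) * G + u ^ p * (h ^ p * N1 + y ^ (p * a) * h) + u ^ (p + 1) * (u ^ (p - 2) * (h ^ p * N2))"
    unfolding E3 E4 by (simp only: distrib_left add.assoc)
  also have "\<dots> = u ^ (p + 1) * (G + r + u ^ (p - 2) * (h ^ p * N2))"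
    unfolding r(2) E2 by (simp only: distrib_left)
  finally have "u ^ (p + 1) * (u ^ (?N - p) * ?f) = u ^ (p + 1) * (G + r + u ^ (p - 2) * (h ^ p * N2))"
    unfolding E1 .
  then have "u ^ (?N - p) * ?f = G + r + u ^ (p - 2) * (h ^ p * N2)"
    using mult_left_cancel[OF power_not_zero[OF u0]] by blast
  then have "G = u ^ (?N - p) * ?f - r - u ^ (p - 2) * (h ^ p * N2)" by simp
  also have "\<dots> \<in> B" by (intro I mem hB r(1) N2B)
  finally show "G \<in> B" .
qed

section \<open>The automorphism\<close>

lemma is_subring_UNIV: "is_subring UNIV"
  by (simp add: is_subring_def)

lemma is_subring_range: "ring_hom_on UNIV h \<Longrightarrow> is_subring (range h)"
  unfolding is_subring_def
  by (auto simp: ring_hom_on_def)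
    (metis rangeI ring_hom_on_def hom_one hom_diff is_subring_UNIV UNIV_I)+

section \<open>Embedding polynomials over the factorial ring into those over its fraction
  field\<close>

lemma Const_hom: "ring_hom_on UNIV Const"
  by (simp add: ring_hom_on_def Const_def single_add mult_single)

lemma Const_eq_0_iff: "Const c = 0 \<longleftrightarrow> c = 0"
  unfolding Const_def by (metis lookup_single_eq lookup_zero single_zero)

lemmas Const_simps = hom_one[OF is_subring_UNIV Const_hom] hom_zero[OF is_subring_UNIV Const_hom]
  hom_add[OF is_subring_UNIV Const_hom UNIV_I UNIV_I] hom_mult[OF is_subring_UNIV Const_hom UNIV_I UNIV_I]
  hom_power[OF is_subring_UNIV Const_hom UNIV_I] hom_diff[OF is_subring_UNIV Const_hom UNIV_I UNIV_I]

lemma inj_Const_to_fract: "inj (\<lambda>r. Const (to_fract r))"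
  by (rule injI) (metis Const_eq_0_iff Const_simps(6) eq_iff_diff_eq_0 to_fract_eq_iff)

lemma Const_to_fract_hom: "ring_hom_on UNIV (\<lambda>r. Const (to_fract r))"
  by (simp add: ring_hom_on_def Const_simps)

interpretation fract_coeff: coeff_hom "\<lambda>r. Const (to_fract r)" Var
  by unfold_locales (simp_all add: Const_simps)

text \<open>\<open>Rxyz\<close> is only a subset of the polynomials over the fraction field, where
  every nonzero constant is a unit. Primality of a factor of \<open>u\<close> is meaningful in the
  source of this map.\<close>

definition fract_mpoly :: "((nat \<Rightarrow>\<^sub>0 nat) \<Rightarrow>\<^sub>0 'r::idom) \<Rightarrow> 'r fract mpolys" where
  "fract_mpoly = mpoly_subst (\<lambda>r. Const (to_fract r)) Var"

lemma fract_mpoly_hom: "ring_hom_on UNIV fract_mpoly"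
  by (simp add: ring_hom_on_def fract_mpoly_def fract_coeff.one fract_coeff.add fract_coeff.mult)

lemma lookup_fract_mpoly: "lookup (fract_mpoly f) m = to_fract (lookup f m)"
proof -
  have "fract_mpoly f = (\<Sum>n\<in>keys f. single n (to_fract (lookup f n)))"
    by (simp add: fract_mpoly_def mpoly_subst_def monom_subst_Var Const_def mult_single)
  then have "lookup (fract_mpoly f) m = (\<Sum>n\<in>keys f. if n = m then to_fract (lookup f m) else 0)"
    by (auto simp: lookup_sum lookup_single when_def intro!: sum.cong)
  then show ?thesis by (simp add: in_keys_iff)
qed

lemma inj_fract_mpoly: "inj fract_mpoly"
  by (rule injI, rule poly_mapping_eqI) (metis lookup_fract_mpoly to_fract_eq_iff)

lemma fract_mpoly_Var: "fract_mpoly (single (single i 1) 1) = Var i"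
  unfolding fract_mpoly_def by (rule fract_coeff.var)

lemma fract_mpoly_const: "fract_mpoly (single 0 r) = Const (to_fract r)"
  unfolding fract_mpoly_def by (rule fract_coeff.const)

section \<open>The setting of the theorem and the restriction of the automorphism\<close>

locale wild_automorphism =
  fixes p l d a b :: nat
    and u :: "'r::{factorial_semiring, idom}"
    and R k Z Rxyz kxyz :: "'r fract mpolys set"
    and x y U lam xt yt g :: "'r fract mpolys"
    and \<sigma> :: "'r fract mpolys \<Rightarrow> 'r fract mpolys"
  assumes p: "prime p" and CHARr: "CHAR('r) = p"
    and R_def: "R = range (\<lambda>r. Const (to_fract r))" and k_def: "k = range Const"
    and x_def: "x = Var 0" and y_def: "y = Var 1" and Z_def: "Z = (\<lambda>i. Var (i + 1)) ` {1..l}"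
    and Rxyz_def: "Rxyz = adjoin R ({x, y} \<union> Z)" and kxyz_def: "kxyz = adjoin k ({x, y} \<union> Z)"
    and u0: "u \<noteq> 0" and u1: "\<not> u dvd 1" and d: "d \<ge> 2" "\<not> p dvd d"
    and U_def: "U = Const (to_fract u)"
    and a_def: "a = p - 2 + (p - 1)\<^sup>2 * (d - 1)" and b_def: "b = (p + 1) * (d - 1) + 1"
    and lam_def: "lam = Const (inverse (to_fract u) ^ (p + 1)) * y ^ (p * (p - 1))
             + Const (inverse (to_fract u) ^ 2) * y ^ (p * a + 1)"
    and xt_def: "xt = x + lam" and yt_def: "yt = y + xt ^ d"
    and g: "g \<in> adjoin R ({U ^ ((p + 1) * d) * yt} \<union> Z)"
    and \<sigma>: "alg_automorphism k kxyz \<sigma>"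
    and \<sigma>_xt: "\<sigma> xt = xt + U ^ b * (1 + U * g)" and \<sigma>_yt: "\<sigma> yt = yt"
    and \<sigma>_Z: "\<And>z. z \<in> Z \<Longrightarrow> \<sigma> z = z"
begin

abbreviation "N \<equiv> (p + 1) * d"
abbreviation "f \<equiv> 1 + U * g"
abbreviation "A \<equiv> adjoin k (insert yt Z)"

text \<open>\<open>U ^ (p + 1) * xt\<close> with denominators cleared, see \<open>W_eq\<close>: a
  multiple of \<open>xt\<close> that visibly lies in \<open>Rxyz\<close>.\<close>

definition "W = U ^ (p + 1) * x + y ^ (p * (p - 1)) + U ^ (p - 1) * y ^ (p * a + 1)"

lemma p2: "p \<ge> 2"
  using p by (rule prime_ge_2_nat)

lemma R_sub: "is_subring Rxyz" and k_sub: "is_subring kxyz" and A_sub: "is_subring A"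
  unfolding Rxyz_def kxyz_def by (rule is_subring_adjoin)+

lemmas RI = subring_intros[OF R_sub]
lemmas kI = subring_intros[OF k_sub]
lemmas AI = subring_intros[OF A_sub]

lemma R_gens: "R \<subseteq> Rxyz" "x \<in> Rxyz" "y \<in> Rxyz" "Z \<subseteq> Rxyz"
  using adjoin_superset[of R "{x, y} \<union> Z"] unfolding Rxyz_def by auto

lemma k_gens: "k \<subseteq> kxyz" "x \<in> kxyz" "y \<in> kxyz" "Z \<subseteq> kxyz"
  using adjoin_superset[of k "{x, y} \<union> Z"] unfolding kxyz_def by auto

lemma A_gens: "k \<subseteq> A" "yt \<in> A" "Z \<subseteq> A"
  using adjoin_superset[of k "insert yt Z"] by auto

lemma R_k: "R \<subseteq> k"
  by (auto simp: R_def k_def)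

lemma Rxyz_kxyz: "Rxyz \<subseteq> kxyz"
  unfolding Rxyz_def by (rule adjoin_minimal[OF k_sub]) (use k_gens R_k in auto)

lemma Const_k: "Const c \<in> k"
  by (simp add: k_def)

lemma U_R: "U \<in> R"
  by (simp add: U_def R_def)

lemma U_Rxyz: "U \<in> Rxyz" and U_kxyz: "U \<in> kxyz" and U_A: "U \<in> A"
  using U_R R_gens R_k k_gens A_gens by blast+

lemma U0: "U \<noteq> 0"
  by (simp add: U_def Const_eq_0_iff u0)

lemma CHARk: "CHAR('r fract mpolys) = p"
  using CHAR_inj_hom[OF Const_to_fract_hom inj_Const_to_fract] CHARr by metis

lemma xt_kxyz: "xt \<in> kxyz" and yt_kxyz: "yt \<in> kxyz"
proof -
  have "lam \<in> kxyz" unfolding lam_def using Const_k k_gens by (intro kI) blast+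
  then show "xt \<in> kxyz" unfolding xt_def by (intro kI k_gens)
  then show "yt \<in> kxyz" unfolding yt_def by (intro kI k_gens)
qed

lemma A_kxyz: "A \<subseteq> kxyz"
  by (rule adjoin_minimal[OF k_sub]) (use k_gens yt_kxyz in auto)

text \<open>The change of variables is triangular: \<open>y = yt - xt ^ d\<close> comes first, then
  \<open>lam\<close> as a polynomial in \<open>y\<close>, then \<open>x = xt - lam\<close>.\<close>

lemma kxyz_eq: "kxyz = adjoin k ({xt, yt} \<union> Z)"
proof (rule antisym)
  let ?K = "adjoin k ({xt, yt} \<union> Z)"
  have K: "is_subring ?K" by (rule is_subring_adjoin)
  have gens: "k \<subseteq> ?K" "xt \<in> ?K" "yt \<in> ?K" "Z \<subseteq> ?K"
    using adjoin_superset[of k "{xt, yt} \<union> Z"] by auto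
  have "y = yt - xt ^ d" by (simp add: yt_def)
  also have "\<dots> \<in> ?K" by (intro subring_intros[OF K] gens)
  finally have y: "y \<in> ?K" .
  then have "lam \<in> ?K" unfolding lam_def using Const_k gens by (intro subring_intros[OF K]) blast+
  then have "xt - lam \<in> ?K" by (intro subring_intros[OF K] gens)
  then have "x \<in> ?K" by (simp add: xt_def)
  then show "kxyz \<subseteq> ?K" unfolding kxyz_def using y gens by (intro adjoin_minimal[OF K]) auto
  show "?K \<subseteq> kxyz" by (rule adjoin_minimal[OF k_sub]) (use k_gens xt_kxyz yt_kxyz in auto)
qed

lemma U_inverse: "n \<le> m \<Longrightarrow> U ^ m * Const (inverse (to_fract u) ^ n) = U ^ (m - n)"
proof -
  assume "n \<le> m"
  then have "to_fract u ^ m * inverse (to_fract u) ^ n = to_fract u ^ (m - n)"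
    using u0 by (simp add: power_diff field_simps)
  then show ?thesis unfolding U_def Const_simps(4,5)[symmetric] by simp
qed

lemma W_eq: "U ^ (p + 1) * xt = W"
proof -
  have "U ^ (p + 1) * xt = U ^ (p + 1) * x + U ^ (p + 1) * Const (inverse (to_fract u) ^ (p + 1)) * y ^ (p * (p - 1))
      + U ^ (p + 1) * Const (inverse (to_fract u) ^ 2) * y ^ (p * a + 1)"
    by (simp only: xt_def lam_def distrib_left mult.assoc add.assoc)
  also have "U ^ (p + 1) * Const (inverse (to_fract u) ^ (p + 1)) = 1" by (subst U_inverse) auto
  also have "U ^ (p + 1) * Const (inverse (to_fract u) ^ 2) = U ^ (p - 1)"
    using p2 by (subst U_inverse) auto
  finally show ?thesis by (simp only: W_def mult_1_left)
qed

lemma U_yt: "U ^ N * yt = U ^ N * y + W ^ d"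
  unfolding yt_def W_eq[symmetric] power_mult_distrib power_mult by (simp only: distrib_left)

lemma W_Rxyz: "W \<in> Rxyz"
  unfolding W_def by (intro RI R_gens U_Rxyz)

lemma U_yt_Rxyz: "U ^ N * yt \<in> Rxyz"
  unfolding U_yt by (intro RI R_gens U_Rxyz W_Rxyz)

lemma g_Rxyz: "g \<in> Rxyz"
proof -
  have "adjoin R ({U ^ N * yt} \<union> Z) \<subseteq> Rxyz"
    by (rule adjoin_minimal[OF R_sub]) (use R_gens U_yt_Rxyz in auto)
  then show ?thesis using g by auto
qed

lemma g_A: "g \<in> A"
proof -
  have "U ^ N * yt \<in> A" by (intro AI U_A A_gens)
  then have "adjoin R ({U ^ N * yt} \<union> Z) \<subseteq> A"
    by (intro adjoin_minimal[OF A_sub]) (use A_gens R_k in auto)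
  then show ?thesis using g by auto
qed

lemma f_A: "f \<in> A"
  by (intro AI U_A g_A)

lemma \<sigma>_hom: "ring_hom_on kxyz \<sigma>" and \<sigma>_bij: "bij_betw \<sigma> kxyz kxyz" and \<sigma>_k: "c \<in> k \<Longrightarrow> \<sigma> c = c"
  using \<sigma> by (auto simp: alg_automorphism_def)

lemma \<sigma>_mem: "c \<in> kxyz \<Longrightarrow> \<sigma> c \<in> kxyz"
  using \<sigma>_bij by (auto simp: bij_betw_def)

lemmas \<sigma>_simps = hom_add[OF k_sub \<sigma>_hom] hom_mult[OF k_sub \<sigma>_hom] hom_power[OF k_sub \<sigma>_hom]

lemma id_hom: "ring_hom_on B (\<lambda>b. b)"
  by (simp add: ring_hom_on_def)

lemma \<sigma>_A: "c \<in> A \<Longrightarrow> \<sigma> c = c"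
proof -
  have "A \<subseteq> {b \<in> kxyz. \<sigma> b = b}"
    by (rule adjoin_minimal[OF subring_eqs[OF k_sub \<sigma>_hom id_hom]])
      (use k_gens yt_kxyz \<sigma>_k \<sigma>_yt \<sigma>_Z in auto)
  then show "c \<in> A \<Longrightarrow> \<sigma> c = c" by auto
qed

text \<open>Since \<open>p + 1 + b = N + 1\<close>, the shift of \<open>W\<close> has one factor
  \<open>U\<close> beyond the power \<open>U ^ N\<close> that clears \<open>yt\<close>.\<close>

lemma \<sigma>_W: "\<sigma> W = W + U ^ (N + 1) * f"
proof -
  have N1: "p + 1 + b = N + 1"
    using d(1) by (cases d) (simp_all add: b_def algebra_simps)
  have "\<sigma> W = U ^ (p + 1) * \<sigma> xt"
    unfolding W_eq[symmetric] using \<sigma>_simps(2)[OF subring_power[OF k_sub U_kxyz] xt_kxyz, of "p + 1"]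
      \<sigma>_A[OF subring_power[OF A_sub U_A], of "p + 1"] by simp
  also have "\<dots> = U ^ (p + 1) * xt + U ^ (p + 1 + b) * f"
    by (simp only: \<sigma>_xt distrib_left power_add mult.assoc)
  finally show ?thesis unfolding N1 W_eq .
qed

text \<open>\<open>perturbation_integral\<close> applied to the increments of \<open>y\<close> and
  \<open>x\<close> under \<open>\<sigma>\<close>. Its two equations come from applying
  \<open>\<sigma>\<close> to \<open>U ^ N * yt\<close>, which is fixed, and to
  \<open>W\<close>.\<close>

lemma \<sigma>_Rxyz: "c \<in> Rxyz \<Longrightarrow> \<sigma> c \<in> Rxyz"
proof -
  have W': "\<sigma> W = U ^ (p + 1) * \<sigma> x + \<sigma> y ^ (p * (p - 1)) + U ^ (p - 1) * \<sigma> y ^ (p * a + 1)"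
    unfolding W_def by (simp only: \<sigma>_simps \<sigma>_A U_A U_kxyz k_gens kI)
  have "\<sigma> (U ^ N * yt) = U ^ N * yt" by (intro \<sigma>_A AI U_A A_gens)
  moreover have "\<sigma> (U ^ N * yt) = U ^ N * \<sigma> y + \<sigma> W ^ d"
    unfolding U_yt using W_Rxyz Rxyz_kxyz by (simp only: \<sigma>_simps \<sigma>_A U_A U_kxyz k_gens kI subset_iff)
  ultimately have "U ^ N * y + W ^ d = U ^ N * \<sigma> y + (W + U ^ (N + 1) * f) ^ d"
    unfolding U_yt \<sigma>_W by simp
  moreover have "s - t + v = w" if "t + w = s + v" for s t v w :: "'r fract mpolys"
    using that by (simp add: algebra_simps)
  ultimately have 1: "U ^ N * (\<sigma> y - y) + (W + U ^ (N + 1) * f) ^ d = W ^ d"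
    unfolding right_diff_distrib by blast
  have 2: "U ^ (N + 1) * f = U ^ (p + 1) * (\<sigma> x - x) + ((y + (\<sigma> y - y)) ^ (p * (p - 1)) - y ^ (p * (p - 1)))
      + U ^ (p - 1) * ((y + (\<sigma> y - y)) ^ (p * a + 1) - y ^ (p * a + 1))"
  proof -
    have "U ^ (N + 1) * f = \<sigma> W - W" by (simp add: \<sigma>_W)
    also have "\<dots> = U ^ (p + 1) * (\<sigma> x - x) + (\<sigma> y ^ (p * (p - 1)) - y ^ (p * (p - 1)))
      + U ^ (p - 1) * (\<sigma> y ^ (p * a + 1) - y ^ (p * a + 1))"
      unfolding W' unfolding W_def right_diff_distrib by simp
    finally show ?thesis by simp
  qed
  have d0: "d > 0" using d(1) by simp
  note HG = perturbation_integral[OF p CHARk R_sub U_Rxyz R_gens(2,3) g_Rxyz U0 d0 a_def W_def refl 1 2]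
  have "y + (\<sigma> y - y) \<in> Rxyz" "x + (\<sigma> x - x) \<in> Rxyz" by (intro RI R_gens HG)+
  then have xy: "\<sigma> y \<in> Rxyz" "\<sigma> x \<in> Rxyz" by simp_all
  have "\<sigma> c = c" if "c \<in> R" for c using that R_k \<sigma>_k by blast
  note \<sigma>_R = this
  have "Rxyz \<subseteq> {c \<in> kxyz. \<sigma> c \<in> Rxyz}"
    unfolding Rxyz_def
    by (rule adjoin_minimal[OF subring_vimage[OF k_sub \<sigma>_hom is_subring_adjoin]], unfold Rxyz_def[symmetric])
      (use xy k_gens R_gens R_k \<sigma>_R \<sigma>_Z in auto)
  then show "c \<in> Rxyz \<Longrightarrow> \<sigma> c \<in> Rxyz" by auto
qed

lemma \<sigma>_pow: "(\<sigma> ^^ n) ` kxyz \<subseteq> kxyz \<and> ring_hom_on kxyz (\<sigma> ^^ n)"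
proof (induction n)
  case (Suc n)
  have "ring_hom_on kxyz (\<lambda>b. \<sigma> ((\<sigma> ^^ n) b))"
    using Suc by (intro ring_hom_on_comp[OF _ \<sigma>_hom]) auto
  then show ?case using Suc \<sigma>_mem by (auto simp: ring_hom_on_def)
qed (simp add: ring_hom_on_def)

text \<open>The shift of \<open>xt\<close> lies in \<open>A\<close> and is itself fixed, so
  \<open>n\<close> iterations add it \<open>n\<close> times; \<open>p\<close> times it is
  zero.\<close>

lemma \<sigma>_order: "c \<in> kxyz \<Longrightarrow> (\<sigma> ^^ p) c = c"
proof -
  have fix_pow: "(\<sigma> ^^ n) c = c" if "\<sigma> c = c" for n c
    using that by (induction n) simp_all
  have "(\<sigma> ^^ n) xt = xt + of_nat n * (U ^ b * f)" for n
  proof (induction n)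
    case (Suc n)
    have m: "of_nat n * (U ^ b * f) \<in> A" by (intro AI U_A f_A)
    then have "\<sigma> (xt + of_nat n * (U ^ b * f)) = xt + U ^ b * f + of_nat n * (U ^ b * f)"
      using A_kxyz by (subst \<sigma>_simps(1)) (auto simp: xt_kxyz \<sigma>_A \<sigma>_xt)
    then show ?case using Suc by (simp add: algebra_simps)
  qed simp
  then have xt: "(\<sigma> ^^ p) xt = xt" using CHARk by (simp flip: CHARk)
  have "adjoin k ({xt, yt} \<union> Z) \<subseteq> {b \<in> kxyz. (\<sigma> ^^ p) b = b}"
    by (rule adjoin_minimal[OF subring_eqs[OF k_sub conjunct2[OF \<sigma>_pow] id_hom]])
      (use k_gens xt_kxyz yt_kxyz xt fix_pow \<sigma>_k \<sigma>_yt \<sigma>_Z in auto)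
  then show "c \<in> kxyz \<Longrightarrow> (\<sigma> ^^ p) c = c" using kxyz_eq by auto
qed

lemma \<sigma>_restrict: "alg_automorphism R Rxyz \<sigma>"
  unfolding alg_automorphism_def
proof (intro conjI ballI)
  show "ring_hom_on Rxyz \<sigma>" by (rule ring_hom_on_subset[OF \<sigma>_hom Rxyz_kxyz])
  show "\<sigma> s = s" if "s \<in> R" for s using that R_k \<sigma>_k by auto
  have inj: "inj_on \<sigma> Rxyz" using \<sigma>_bij Rxyz_kxyz by (auto simp: bij_betw_def intro: inj_on_subset)
  have "\<sigma> ` Rxyz = Rxyz"
  proof (intro equalityI subsetI)
    fix c assume c: "c \<in> Rxyz"
    have "(\<sigma> ^^ n) c \<in> Rxyz" for n using c \<sigma>_Rxyz by (induction n) auto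
    moreover have "\<sigma> ((\<sigma> ^^ (p - 1)) c) = c"
      using \<sigma>_order[of c] c Rxyz_kxyz p2 by (cases p) auto
    ultimately show "c \<in> \<sigma> ` Rxyz" by (metis imageI)
  qed (use \<sigma>_Rxyz in auto)
  with inj show "bij_betw \<sigma> Rxyz Rxyz" by (simp add: bij_betw_def)
qed

end

section \<open>Transport to the ring in one variable\<close>

context wild_automorphism
begin

text \<open>Elements with a denominator from \<open>'r\<close> form a subring containing all
  generators. This supplies the invariant denominators for
  \<open>Ga_action_localize\<close>.\<close>

lemma R_denominator:
  assumes "c \<in> kxyz"
  obtains m where "m \<noteq> 0" "Const (to_fract m) * c \<in> Rxyz"
proof -
  let ?T = "{c \<in> kxyz. \<exists>m. m \<noteq> 0 \<and> Const (to_fract m) * c \<in> Rxyz}"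
  have R: "Const (to_fract m) \<in> Rxyz" for m using R_gens(1) by (auto simp: R_def)
  have R1: "c \<in> Rxyz \<Longrightarrow> Const (to_fract 1) * c \<in> Rxyz" for c by (simp add: Const_simps)
  have "is_subring ?T"
    unfolding is_subring_def
  proof (intro conjI ballI)
    show "1 \<in> ?T" using R1[OF RI(1)] kI(1) by (auto intro: exI[of _ 1])
    fix c e assume "c \<in> ?T" "e \<in> ?T"
    then obtain m n where mn: "m \<noteq> 0" "n \<noteq> 0" "Const (to_fract m) * c \<in> Rxyz" "Const (to_fract n) * e \<in> Rxyz"
      and ce: "c \<in> kxyz" "e \<in> kxyz" by auto
    have "Const (to_fract (m * n)) * (c - e)
        = Const (to_fract n) * (Const (to_fract m) * c) - Const (to_fract m) * (Const (to_fract n) * e)"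
      by (simp add: Const_simps algebra_simps)
    also have "\<dots> \<in> Rxyz" by (intro RI R mn)
    finally show "c - e \<in> ?T" using mn(1,2) ce kI by (auto intro!: exI[of _ "m * n"])
    have "Const (to_fract (m * n)) * (c * e)
        = (Const (to_fract m) * c) * (Const (to_fract n) * e)"
      by (simp add: Const_simps algebra_simps)
    also have "\<dots> \<in> Rxyz" by (intro RI mn)
    finally show "c * e \<in> ?T" using mn(1,2) ce kI by (auto intro!: exI[of _ "m * n"])
  qed
  moreover have "k \<subseteq> ?T"
  proof
    fix c assume c: "c \<in> k"
    then obtain c' where c': "c = Const c'" by (auto simp: k_def)
    obtain n m where nm: "c' = Fract n m" "m \<noteq> 0" by (cases c')
    have "Const (to_fract m) * c = Const (to_fract n)"
      using nm by (simp add: c' Fract_conv_to_fract flip: Const_simps)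
    then show "c \<in> ?T" using c k_gens(1) R nm(2) by (auto intro!: exI[of _ m])
  qed
  moreover have "{x, y} \<union> Z \<subseteq> ?T"
    using R1 k_gens R_gens by (auto intro!: exI[of _ 1])
  ultimately have "kxyz \<subseteq> ?T" unfolding kxyz_def by (intro adjoin_minimal)
  then show ?thesis using assms that by blast
qed

text \<open>Scaled so that \<open>\<sigma>\<close> shifts it by \<open>f\<close> itself, as the
  definition of stability demands.\<close>

definition "X0 = Const (inverse (to_fract u) ^ b) * xt"

lemma X0_kxyz: "X0 \<in> kxyz"
  unfolding X0_def using Const_k k_gens(1) xt_kxyz by (auto intro!: kI(3))

lemma U_X0: "U ^ b * X0 = xt"
  unfolding X0_def using U_inverse[of b b] by (simp flip: mult.assoc)

lemma \<sigma>_X0: "\<sigma> X0 = X0 + f"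
proof -
  have "\<sigma> X0 = Const (inverse (to_fract u) ^ b) * (xt + U ^ b * f)"
    unfolding X0_def using Const_k k_gens(1) xt_kxyz by (simp add: \<sigma>_simps(2) subset_iff \<sigma>_k \<sigma>_xt)
  also have "\<dots> = X0 + (U ^ b * Const (inverse (to_fract u) ^ b)) * f"
    by (simp add: X0_def algebra_simps)
  finally show ?thesis using U_inverse[of b b] by simp
qed

text \<open>
  The isomorphism of \<open>k[x, y, z]\<close> with \<open>A[X]\<close>, where \<open>X = x\<^sub>t / u\<^sup>b\<close>; its inverse is evaluation
  at \<^const>\<open>X0\<close>. The image of \<open>x\<close> is \<open>u\<^sup>b X - \<lambda>\<close> with the image of \<open>y\<close> substituted into \<open>\<lambda>\<close>.
\<close>

definition \<theta> :: "'r fract mpolys \<Rightarrow> 'r fract mpolys poly" where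
  "\<theta> = mpoly_subst (\<lambda>c. [:Const c:])
    (\<lambda>i. if i = 0 then [:0, U ^ b:] - poly (map_poly (\<lambda>c. [:c:])
            (monom (Const (inverse (to_fract u) ^ (p + 1))) (p * (p - 1))
              + monom (Const (inverse (to_fract u) ^ 2)) (p * a + 1))) ([:yt:] - [:0, U ^ b:] ^ d)
         else if i = 1 then [:yt:] - [:0, U ^ b:] ^ d
         else [:Var i:])"

interpretation subst: coeff_hom "\<lambda>c. [:Const c:]" v for v :: "nat \<Rightarrow> 'r fract mpolys poly"
  by unfold_locales (simp_all add: Const_simps one_pCons)

lemma \<theta>_hom: "ring_hom_on B \<theta>"
  by (simp add: ring_hom_on_def \<theta>_def subst.one subst.add subst.mult)

lemmas \<theta>_simps = hom_add[OF is_subring_UNIV \<theta>_hom UNIV_I UNIV_I] hom_mult[OF is_subring_UNIV \<theta>_hom UNIV_I UNIV_I]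
  hom_power[OF is_subring_UNIV \<theta>_hom UNIV_I] hom_zero[OF is_subring_UNIV \<theta>_hom]

lemma \<theta>_Const: "\<theta> (Const c) = [:Const c:]"
proof -
  have "\<theta> (single 0 c) = [:Const c:]" unfolding \<theta>_def by (rule subst.const)
  then show ?thesis by (simp add: Const_def)
qed

lemma \<theta>_y: "\<theta> y = [:yt:] - [:0, U ^ b:] ^ d"
  unfolding y_def Var_def \<theta>_def by (subst subst.var) simp

lemma \<theta>_x: "\<theta> x = [:0, U ^ b:] - \<theta> lam"
proof -
  let ?m = "monom (Const (inverse (to_fract u) ^ (p + 1))) (p * (p - 1))
              + monom (Const (inverse (to_fract u) ^ 2)) (p * a + 1)"
  have "\<theta> x = [:0, U ^ b:] - poly (map_poly (\<lambda>c. [:c:]) ?m) (\<theta> y)"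
    unfolding \<theta>_y unfolding x_def Var_def \<theta>_def by (subst subst.var) simp
  also have "map_poly (\<lambda>c. [:c:]) ?m = monom [:Const (inverse (to_fract u) ^ (p + 1)):] (p * (p - 1))
              + monom [:Const (inverse (to_fract u) ^ 2):] (p * a + 1)"
    by (rule poly_eqI) (simp add: coeff_map_poly)
  also have "poly \<dots> (\<theta> y) = \<theta> lam"
    unfolding lam_def by (simp add: \<theta>_simps \<theta>_Const poly_monom)
  finally show ?thesis .
qed

lemma \<theta>_Z: "z \<in> Z \<Longrightarrow> \<theta> z = [:z:]"
proof -
  assume "z \<in> Z"
  then obtain i where i: "z = Var i" "i \<noteq> 0" "i \<noteq> Suc 0" by (auto simp: Z_def)
  have "\<theta> (single (single i 1) 1) = [:Var i:]" unfolding \<theta>_def by (subst subst.var) (simp add: i)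
  then show ?thesis by (simp add: i(1) Var_def)
qed

lemma \<theta>_xt: "\<theta> xt = [:0, U ^ b:]"
  by (simp add: xt_def \<theta>_simps \<theta>_x)

lemma \<theta>_yt: "\<theta> yt = [:yt:]"
  using arg_cong[OF yt_def, of \<theta>] by (simp add: \<theta>_simps \<theta>_y \<theta>_xt)

lemma const_poly_hom: "ring_hom_on B (\<lambda>c. [:c:])"
  by (simp add: ring_hom_on_def one_pCons)

lemma \<theta>_A: "c \<in> A \<Longrightarrow> \<theta> c = [:c:]"
proof -
  have "A \<subseteq> {c \<in> UNIV. \<theta> c = [:c:]}"
    by (rule adjoin_minimal[OF subring_eqs[OF is_subring_UNIV \<theta>_hom const_poly_hom]])
      (use \<theta>_Const \<theta>_yt \<theta>_Z in \<open>auto simp: k_def\<close>)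
  then show "c \<in> A \<Longrightarrow> \<theta> c = [:c:]" by auto
qed

lemma \<theta>_X0: "\<theta> X0 = [:0, 1:]"
  using U_inverse[of b b] by (simp add: X0_def \<theta>_simps \<theta>_Const \<theta>_xt mult.commute)

lemma \<theta>_poly: "q \<in> polys_over A \<Longrightarrow> \<theta> (poly q X0) = q"
proof -
  assume q: "q \<in> polys_over A"
  then have c: "\<theta> (coeff q i) = [:coeff q i:]" for i by (simp add: polys_over_def \<theta>_A)
  have "\<theta> (poly q X0) = (\<Sum>i\<le>degree q. \<theta> (coeff q i) * \<theta> X0 ^ i)"
    by (rule hom_poly[OF is_subring_UNIV \<theta>_hom]) (auto simp: polys_over_def)
  also have "\<dots> = (\<Sum>i\<le>degree q. monom (coeff q i) i)"
    by (simp add: c \<theta>_X0 monom_altdef)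
  also have "\<dots> = q" by (rule poly_as_sum_of_monoms)
  finally show ?thesis .
qed

lemma AX_sub: "is_subring (polys_over A)"
  by (rule subring_polys_over[OF A_sub])

lemma const_polys_over: "c \<in> A \<Longrightarrow> [:c:] \<in> polys_over A"
  by (auto simp: polys_over_def coeff_pCons AI(4) split: nat.splits)

lemma \<theta>_mem: "c \<in> kxyz \<Longrightarrow> \<theta> c \<in> polys_over A"
proof -
  have X: "\<theta> xt \<in> polys_over A"
    unfolding \<theta>_xt by (auto simp: polys_over_def coeff_pCons split: nat.splits intro: AI U_A)
  have "kxyz \<subseteq> {c \<in> UNIV. \<theta> c \<in> polys_over A}"
    unfolding kxyz_eq
    by (rule adjoin_minimal[OF subring_vimage[OF is_subring_UNIV \<theta>_hom AX_sub]])
      (use X A_gens \<theta>_A const_polys_over in auto)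
  then show "c \<in> kxyz \<Longrightarrow> \<theta> c \<in> polys_over A" by auto
qed

lemma eval_hom: "ring_hom_on B (\<lambda>q. poly q X0)"
  by (simp add: ring_hom_on_def)

lemma eval_mem: "q \<in> polys_over A \<Longrightarrow> poly q X0 \<in> kxyz"
  using A_kxyz by (intro poly_in_subring[OF k_sub _ X0_kxyz]) (auto simp: polys_over_def)

lemma poly_\<theta>: "c \<in> kxyz \<Longrightarrow> poly (\<theta> c) X0 = c"
proof -
  have h: "ring_hom_on kxyz (\<lambda>c. poly (\<theta> c) X0)"
    by (rule ring_hom_on_comp[OF \<theta>_hom eval_hom[of UNIV]]) simp
  have "adjoin k ({xt, yt} \<union> Z) \<subseteq> {c \<in> kxyz. poly (\<theta> c) X0 = c}"
    by (rule adjoin_minimal[OF subring_eqs[OF k_sub h id_hom]])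
      (use k_gens xt_kxyz yt_kxyz A_gens \<theta>_A \<theta>_xt U_X0 in \<open>auto simp: mult.commute\<close>)
  then show "c \<in> kxyz \<Longrightarrow> poly (\<theta> c) X0 = c" using kxyz_eq by auto
qed

text \<open>After evaluation at \<open>X0\<close>, \<open>\<sigma>\<close> fixes the coefficients
  and shifts \<open>X0\<close> by \<open>f\<close>; \<open>\<theta>_poly\<close> then returns to
  polynomials.\<close>

lemma \<sigma>_poly: "q \<in> polys_over A \<Longrightarrow> \<theta> (\<sigma> (poly q X0)) = pcompose q [:f, 1:]"
proof -
  assume q: "q \<in> polys_over A"
  then have c: "coeff q i \<in> A" for i by (simp add: polys_over_def)
  have "\<sigma> (poly q X0) = (\<Sum>i\<le>degree q. \<sigma> (coeff q i) * \<sigma> X0 ^ i)"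
    using c A_kxyz by (intro hom_poly[OF k_sub \<sigma>_hom _ X0_kxyz]) (auto simp: polys_over_def)
  also have "\<dots> = poly q (X0 + f)" by (simp add: \<sigma>_A c \<sigma>_X0 poly_altdef)
  also have "\<dots> = poly (pcompose q [:f, 1:]) X0" by (simp add: poly_pcompose add.commute)
  finally have eq: "\<sigma> (poly q X0) = poly (pcompose q [:f, 1:]) X0" .
  have f1: "[:f, 1:] \<in> polys_over A"
    using f_A by (auto simp: polys_over_def coeff_pCons split: nat.splits intro: AI)
  have "pcompose q [:f, 1:] = poly (map_poly (\<lambda>c. [:c:]) q) [:f, 1:]"
    by (simp add: pcompose_altdef)
  also have "\<dots> \<in> polys_over A"
    using c f1 const_polys_over
    by (intro poly_in_subring[OF AX_sub]) (auto simp: polys_over_def[of "polys_over A"] coeff_map_poly)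
  finally show ?thesis unfolding eq by (rule \<theta>_poly)
qed

text \<open>The action is extended to \<open>kxyz\<close> as \<open>E1\<close>, rescaled by
  \<open>c\<close> to \<open>E2\<close> and carried to A[X] as \<open>E3\<close>, where stability
  applies; the result is then traced back. The factor \<open>U ^ N\<close> brings \<open>yt\<close>
  into \<open>Rxyz\<close>, the domain of \<open>E\<close>.\<close>

lemma exponential_yt_invariant:
  assumes stable: "f_stable_over f k A" and E: "Ga_action_over R Rxyz E"
    and c: "c \<in> invariant_ring Rxyz E" and \<sigma>E: "\<And>e. e \<in> Rxyz \<Longrightarrow> \<sigma> e = specialize E c e"
  shows "E (U ^ N * yt) = [:U ^ N * yt:]"
proof -
  have E': "Ga_action Rxyz E" and RE: "R \<subseteq> invariant_ring Rxyz E" using E by (auto simp: Ga_action_over_def)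
  have Rinv: "Const (to_fract m) \<in> invariant_ring Rxyz E" for m using RE by (auto simp: R_def)
  have unit: "Const (inverse (to_fract m)) * Const (to_fract m) = 1" if "m \<noteq> 0" for m
    using that by (simp add: Const_simps(1) flip: Const_simps(4))
  have den: "\<exists>r\<in>invariant_ring Rxyz E. \<exists>s\<in>kxyz. s * r = 1 \<and> r * e \<in> Rxyz" if e: "e \<in> kxyz" for e
  proof -
    obtain m where m: "m \<noteq> 0" "Const (to_fract m) * e \<in> Rxyz" using R_denominator[OF e] .
    show ?thesis
      by (rule bexI[OF _ Rinv[of m]], rule bexI[of _ "Const (inverse (to_fract m))"])
        (use unit[OF m(1)] m(2) Const_k k_gens(1) in auto)
  qed
  obtain E1 where E1: "Ga_action kxyz E1"
    and E1_eq: "\<And>e r s. e \<in> kxyz \<Longrightarrow> r \<in> invariant_ring Rxyz E \<Longrightarrow> s * r = 1 \<Longrightarrow> r * e \<in> Rxyz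
      \<Longrightarrow> E1 e = smult s (E (r * e))"
    using Ga_action_localize[OF R_sub E' k_sub Rxyz_kxyz den] by blast
  have E1_E: "E1 e = E e" if "e \<in> Rxyz" for e
    using E1_eq[of e 1 1] that Rxyz_kxyz subring_one[OF subring_invariant_ring[OF R_sub E']] by auto
  have E1_k: "E1 e = [:e:]" if e: "e \<in> k" for e
  proof -
    obtain e' where e': "e = Const e'" using e by (auto simp: k_def)
    obtain n m where nm: "e' = Fract n m" "m \<noteq> 0" by (cases e')
    have m: "Const (to_fract m) * e = Const (to_fract n)"
      using nm by (simp add: e' Fract_conv_to_fract flip: Const_simps)
    have "E1 e = smult (Const (inverse (to_fract m))) (E (Const (to_fract n)))"
      using E1_eq[of e "Const (to_fract m)"] e k_gens(1) Rinv[of m] Rinv[of n] unit[OF nm(2)]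
      unfolding m by (auto simp: invariant_ring_def)
    also have "\<dots> = [:Const (inverse (to_fract m)) * (Const (to_fract m) * e):]"
      unfolding m using Rinv[of n] by (simp add: invariant_ring_def)
    also have "\<dots> = [:e:]" using unit[OF nm(2)] by (simp flip: mult.assoc)
    finally show ?thesis .
  qed
  have c1: "c \<in> invariant_ring kxyz E1"
    using c Rxyz_kxyz E1_E by (auto simp: invariant_ring_def)
  have \<sigma>E1: "\<sigma> e = poly (E1 e) c" if e: "e \<in> kxyz" for e
  proof -
    obtain m where m: "m \<noteq> 0" "Const (to_fract m) * e \<in> Rxyz" using R_denominator[OF e] .
    have "\<sigma> (Const (to_fract m) * e) = Const (to_fract m) * \<sigma> e"
      using e Const_k k_gens(1) by (simp add: \<sigma>_simps(2) subset_iff \<sigma>_k)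
    then have "Const (inverse (to_fract m)) * Const (to_fract m) * \<sigma> e
        = Const (inverse (to_fract m)) * poly (E (Const (to_fract m) * e)) c"
      using \<sigma>E[OF m(2)] by (simp add: specialize_def mult.assoc)
    then show ?thesis using E1_eq[OF e Rinv[of m] unit[OF m(1)] m(2)] unit[OF m(1)] by simp
  qed
  define E2 where "E2 e = pcompose (E1 e) [:0, c:]" for e
  have E2: "Ga_action kxyz E2" unfolding E2_def by (rule Ga_action_scale[OF k_sub E1 c1])
  define E3 where "E3 q = map_poly \<theta> (E2 (poly q X0))" for q
  have E3: "Ga_action (polys_over A) E3"
    unfolding E3_def
    by (rule Ga_action_transport[OF k_sub E2 AX_sub \<theta>_hom _ eval_hom _ poly_\<theta> \<theta>_poly])
      (use \<theta>_mem eval_mem in auto)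
  have over: "Ga_action_over ((\<lambda>c. [:c:]) ` k) (polys_over A) E3"
  proof -
    have "E3 [:e:] = [:[:e:]:]" if "e \<in> k" for e
      using that A_gens(1) by (simp add: E3_def E2_def E1_k map_poly_pCons \<theta>_simps(4) \<theta>_A subset_iff)
    then show ?thesis
      using E3 A_gens(1) const_polys_over by (auto simp: Ga_action_over_def invariant_ring_def)
  qed
  have spec: "specialize E3 1 q = pcompose q [:f, 1:]" if q: "q \<in> polys_over A" for q
  proof -
    let ?F = "E2 (poly q X0)"
    \<comment> \<open>The sum runs to the degree of \<open>?F\<close>, since the degree of
      \<open>map_poly \<theta> ?F\<close> is known only to be at most that.\<close>
    have "poly (\<Sum>i\<le>degree ?F. monom (coeff (map_poly \<theta> ?F) i) i) 1 = (\<Sum>i\<le>degree ?F. coeff (map_poly \<theta> ?F) i)"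
      by (simp add: poly_sum poly_monom)
    then have "poly (map_poly \<theta> ?F) 1 = (\<Sum>i\<le>degree ?F. coeff (map_poly \<theta> ?F) i)"
      by (simp only: poly_as_sum_of_monoms'[OF map_poly_degree_leq])
    also have "\<dots> = \<theta> (poly ?F 1)"
      by (simp add: coeff_map_poly \<theta>_simps(4) poly_altdef hom_sum[OF is_subring_UNIV \<theta>_hom])
    also have "poly ?F 1 = \<sigma> (poly q X0)"
      by (simp add: E2_def poly_pcompose \<sigma>E1 eval_mem q)
    finally show ?thesis by (simp add: specialize_def E3_def \<sigma>_poly q)
  qed
  have "[:yt:] \<in> invariant_ring (polys_over A) E3"
    using stable over spec A_gens(2) by (auto simp: f_stable_over_def)
  then have inv: "map_poly \<theta> (E2 yt) = [:[:yt:]:]" by (simp add: invariant_ring_def E3_def)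
  have co: "coeff (E1 yt) i \<in> kxyz" for i by (rule Ga_coeff[OF k_sub E1 yt_kxyz])
  have f0: "f \<noteq> 0" using stable by (simp add: f_stable_over_def)
  \<comment> \<open>With \<open>c = 0\<close> the element \<open>W\<close> would be fixed, against
    its nonzero shift \<open>U ^ (N + 1) * f\<close>.\<close>
  have c0: "c \<noteq> 0"
  proof
    assume "c = 0"
    then have "\<sigma> W = W"
      using \<sigma>E[OF W_Rxyz] Ga_coeff_0[OF R_sub E' W_Rxyz] by (simp add: specialize_def poly_0_coeff_0)
    then show False using \<sigma>_W U0 f0 by simp
  qed
  have "E1 yt = [:yt:]"
  proof (rule poly_eqI)
    fix i
    \<comment> \<open>Evaluation at \<open>X0\<close> undoes \<open>\<theta>\<close>, and cancelling
      \<open>c ^ i\<close> undoes the rescaling.\<close>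
    have "\<theta> (c ^ i * coeff (E1 yt) i) = coeff [:[:yt:]:] i"
      by (simp add: E2_def coeff_map_poly \<theta>_simps(4) coeff_pcompose_linear flip: inv)
    then have "poly (\<theta> (c ^ i * coeff (E1 yt) i)) X0 = coeff [:yt:] i"
      by (simp add: coeff_pCons split: nat.splits)
    then have "c ^ i * coeff (E1 yt) i = coeff [:yt:] i"
      using c Rxyz_kxyz co by (subst (asm) poly_\<theta>) (auto simp: invariant_ring_def intro!: kI(3,7))
    then show "coeff (E1 yt) i = coeff [:yt:] i"
      using c0 by (cases i) auto
  qed
  moreover have "E1 (U ^ N * yt) = E1 U ^ N * E1 yt"
    by (simp only: hom_mult[OF k_sub Ga_hom[OF k_sub E1]] hom_power[OF k_sub Ga_hom[OF k_sub E1]] U_kxyz yt_kxyz kI)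
  moreover have "E1 U = [:U:]" using E1_k U_R R_k by blast
  ultimately have "E (U ^ N * yt) = [:U:] ^ N * [:yt:]" using E1_E[OF U_yt_Rxyz] by simp
  then show ?thesis by (simp add: poly_const_pow mult.commute)
qed

end

section \<open>Pulling back to polynomials over the factorial ring\<close>

lemma polys_over_range:
  assumes "inj h" "h 0 = 0" "q \<in> polys_over (range h)"
  obtains q' where "map_poly h q' = q"
proof
  have "inv h 0 = 0" using assms(1,2) by (metis inv_f_f)
  then show "map_poly h (map_poly (inv h) q) = q"
    using assms by (intro poly_eqI) (auto simp: coeff_map_poly polys_over_def f_inv_into_f)
qed

lemma inj_map_poly: "inj h \<Longrightarrow> h 0 = 0 \<Longrightarrow> inj (map_poly h)"
  by (rule injI, rule poly_eqI) (metis coeff_map_poly injD)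

context wild_automorphism
begin

lemma Rxyz_range: "Rxyz \<subseteq> range fract_mpoly"
  unfolding Rxyz_def
proof (rule adjoin_minimal[OF is_subring_range[OF fract_mpoly_hom]])
  show "R \<subseteq> range fract_mpoly"
    unfolding R_def using fract_mpoly_const by (metis image_subsetI rangeI)
  show "{x, y} \<union> Z \<subseteq> range fract_mpoly"
    unfolding x_def y_def Z_def using fract_mpoly_Var by (auto intro: range_eqI[OF sym])
qed

text \<open>The relations between \<open>E x\<close>, \<open>E y\<close> and \<open>E W\<close> are
  pulled back along the injective \<open>map_poly fract_mpoly\<close>, and
  \<open>no_exponential_core\<close> refutes them over the factorial ring.\<close>

lemma not_exponential:
  assumes stable: "f_stable_over f k A"
  shows "\<not> exponential_over R Rxyz \<sigma>"
proof
  assume "exponential_over R Rxyz \<sigma>"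
  then obtain E c where E: "Ga_action_over R Rxyz E" and c: "c \<in> invariant_ring Rxyz E"
    and \<sigma>E: "\<And>e. e \<in> Rxyz \<Longrightarrow> \<sigma> e = specialize E c e"
    by (auto simp: exponential_over_def)
  have E': "Ga_action Rxyz E" and EU: "E U = [:U:]"
    using E U_R by (auto simp: Ga_action_over_def invariant_ring_def)
  have cR: "c \<in> Rxyz" using c by (simp add: invariant_ring_def)
  note E_simps = hom_add[OF R_sub Ga_hom[OF R_sub E']] hom_mult[OF R_sub Ga_hom[OF R_sub E']]
    hom_power[OF R_sub Ga_hom[OF R_sub E']] EU
  have EW: "E W = [:U:] ^ (p + 1) * E x + E y ^ (p * (p - 1)) + [:U:] ^ (p - 1) * E y ^ (p * a + 1)"
    unfolding W_def by (simp only: E_simps U_Rxyz R_gens RI)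
  have "E (U ^ N * yt) = [:U:] ^ N * E y + E W ^ d"
    unfolding U_yt by (simp only: E_simps U_Rxyz R_gens RI W_Rxyz)
  moreover have "[:U ^ N * yt:] = [:U:] ^ N * [:y:] + [:W:] ^ d"
    unfolding U_yt by (simp add: poly_const_pow mult.commute)
  ultimately have Eyt: "[:U:] ^ N * E y + E W ^ d = [:U:] ^ N * [:y:] + [:W:] ^ d"
    using exponential_yt_invariant[OF stable E c \<sigma>E] by (simp only:)

  let ?h = "fract_mpoly :: ((nat \<Rightarrow>\<^sub>0 nat) \<Rightarrow>\<^sub>0 'r) \<Rightarrow> _"
  let ?F = "map_poly ?h"
  have h0: "?h 0 = 0" by (rule hom_zero[OF is_subring_UNIV fract_mpoly_hom])
  note h_simps = hom_one[OF is_subring_UNIV fract_mpoly_hom]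
    hom_add[OF is_subring_UNIV fract_mpoly_hom UNIV_I UNIV_I]
    hom_mult[OF is_subring_UNIV fract_mpoly_hom UNIV_I UNIV_I]
    hom_power[OF is_subring_UNIV fract_mpoly_hom UNIV_I]
  have inj: "inj ?F" by (rule inj_map_poly[OF inj_fract_mpoly h0])
  have F_hom: "ring_hom_on UNIV ?F"
    using hom_map_poly[OF is_subring_UNIV fract_mpoly_hom] by (simp add: polys_over_def)
  note F_simps = hom_add[OF is_subring_UNIV F_hom UNIV_I UNIV_I]
    hom_mult[OF is_subring_UNIV F_hom UNIV_I UNIV_I] hom_diff[OF is_subring_UNIV F_hom UNIV_I UNIV_I]
    hom_power[OF is_subring_UNIV F_hom UNIV_I]
  have F_const: "?F [:e:] = [:?h e:]" for e by (simp add: map_poly_pCons h0)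
  have "?h s \<noteq> 0" if "s \<noteq> 0" for s using that inj_fract_mpoly h0 by (metis injD)
  then have degree_h: "degree (?F q) = degree q" for q by (rule degree_map_poly)
  have poly_F: "poly (?F q) (?h e) = ?h (poly q e)" for q e
    using hom_poly[OF is_subring_UNIV fract_mpoly_hom, of q e]
    by (simp add: polys_over_def poly_altdef coeff_map_poly h0 degree_h)

  have lift: "\<exists>q. ?F q = E e - [:e:]" if "e \<in> Rxyz" for e
  proof -
    have "E e - [:e:] \<in> polys_over (range ?h)"
      unfolding polys_over_def
    proof (rule CollectI, rule allI)
      fix i
      have "coeff (E e - [:e:]) i \<in> Rxyz"
        using that by (auto simp: coeff_pCons Ga_coeff[OF R_sub E'] split: nat.splits intro: RI)
      then show "coeff (E e - [:e:]) i \<in> range ?h" using Rxyz_range by blast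
    qed
    then show ?thesis using polys_over_range[OF inj_fract_mpoly h0] by blast
  qed
  obtain H where H: "?F H = E y - [:y:]" using lift R_gens by blast
  obtain G where G: "?F G = E x - [:x:]" using lift R_gens by blast
  obtain c' where c': "?h c' = c" using cR Rxyz_range by blast
  obtain g' where g': "?h g' = g" using g_Rxyz Rxyz_range by blast
  define x' where "x' = (single (single 0 1) 1 :: (nat \<Rightarrow>\<^sub>0 nat) \<Rightarrow>\<^sub>0 'r)"
  define y' where "y' = (single (single 1 1) 1 :: (nat \<Rightarrow>\<^sub>0 nat) \<Rightarrow>\<^sub>0 'r)"
  define U' where "U' = (single 0 u :: (nat \<Rightarrow>\<^sub>0 nat) \<Rightarrow>\<^sub>0 'r)"
  have hx: "?h x' = x" and hy: "?h y' = y" and hU: "?h U' = U"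
    unfolding x'_def y'_def U'_def x_def y_def U_def by (rule fract_mpoly_Var fract_mpoly_const)+
  define W' where "W' = U' ^ (p + 1) * x' + y' ^ (p * (p - 1)) + U' ^ (p - 1) * y' ^ (p * a + 1)"
  have hW: "?h W' = W" unfolding W'_def W_def by (simp only: h_simps hx hy hU)
  define P where "P = [:U':] ^ (p + 1) * G + (([:y':] + H) ^ (p * (p - 1)) - [:y':] ^ (p * (p - 1)))
              + [:U':] ^ (p - 1) * (([:y':] + H) ^ (p * a + 1) - [:y':] ^ (p * a + 1))"
  have W_poly: "[:W:] = [:U:] ^ (p + 1) * [:x:] + [:y:] ^ (p * (p - 1)) + [:U:] ^ (p - 1) * [:y:] ^ (p * a + 1)"
    unfolding W_def
    by (simp only: hom_add[OF is_subring_UNIV const_poly_hom UNIV_I UNIV_I]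
        hom_mult[OF is_subring_UNIV const_poly_hom UNIV_I UNIV_I]
        hom_power[OF is_subring_UNIV const_poly_hom UNIV_I])
  have FP: "?F P = E W - [:W:]"
  proof -
    have "?F P = [:U:] ^ (p + 1) * (E x - [:x:]) + (E y ^ (p * (p - 1)) - [:y:] ^ (p * (p - 1)))
              + [:U:] ^ (p - 1) * (E y ^ (p * a + 1) - [:y:] ^ (p * a + 1))"
      unfolding P_def by (simp only: F_simps F_const H G hU hy add_diff_cancel_left' add.commute[of "[:y:]"] diff_add_cancel)
    also have "\<dots> = E W - [:W:]"
      unfolding EW W_poly right_diff_distrib by simp
    finally show ?thesis .
  qed

  \<comment> \<open>Any prime factor of \<open>u\<close> will do; \<open>e\<close> below is its
    multiplicity in \<open>u\<close>.\<close>
  obtain q where q: "q dvd u" "prime q" using prime_divisor_exists[OF u0] u1 by blast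
  obtain v where v: "u = q ^ multiplicity q u * v" "\<not> q dvd v"
    using multiplicity_decompose'[OF u0, of q] q(2) by (metis not_prime_unit)
  define e where "e = multiplicity q u"
  have e0: "e > 0" using v q(1) unfolding e_def by (cases "multiplicity q u") auto
  let ?q = "single 0 q :: (nat \<Rightarrow>\<^sub>0 nat) \<Rightarrow>\<^sub>0 'r"
  have sp: "(single 0 s :: (nat \<Rightarrow>\<^sub>0 nat) \<Rightarrow>\<^sub>0 'r) ^ n = single 0 (s ^ n)" for s n
    by (induction n) (simp_all add: mult_single)
  have Uq: "U' = ?q ^ e * single 0 v"
    unfolding U'_def sp mult_single using v(1) by (simp add: e_def)
  have qv: "\<not> ?q dvd single 0 v"
    using v(2) by (auto simp: const_dvd_iff lookup_single intro!: exI[of _ 0])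
  \<comment> \<open>The coefficient of \<open>y'\<close> at \<open>single 1 1\<close> is 1, which no
    prime divides.\<close>
  have qy: "\<not> ?q dvd y'"
    using q(2) unfolding y'_def const_dvd_iff
    by (auto intro!: exI[of _ "single 1 1"] dest: not_prime_unit)
  have qp: "prime_elem ?q" by (rule prime_elem_single[OF prime_imp_prime_elem[OF q(2)]])
  have CHAR': "CHAR((nat \<Rightarrow>\<^sub>0 nat) \<Rightarrow>\<^sub>0 'r) = p"
    using CHAR_inj_hom[OF fract_mpoly_hom inj_fract_mpoly] CHARk by metis
  have poly0: "poly q' 0 = 0" if "?F q' = E s - [:s:]" "s \<in> Rxyz" for q' s
  proof -
    have "?h (poly q' 0) = poly (E s - [:s:]) 0" using poly_F[of q' 0] by (simp add: h0 that(1))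
    also have "\<dots> = 0" using Ga_coeff_0[OF R_sub E' that(2)] by (simp add: poly_0_coeff_0)
    finally show ?thesis using inj_fract_mpoly h0 by (metis injD)
  qed
  have H': "[:U':] ^ N * H + ([:W':] + P) ^ d = [:W':] ^ d"
  proof (rule injD[OF inj])
    have "[:U:] ^ N * E y - [:U:] ^ N * [:y:] + E W ^ d = [:W:] ^ d"
      using Eyt by (simp add: algebra_simps)
    then show "?F ([:U':] ^ N * H + ([:W':] + P) ^ d) = ?F ([:W':] ^ d)"
      by (simp only: F_simps F_const H FP hU hW right_diff_distrib add.commute[of "[:W:]"] diff_add_cancel)
  qed
  \<comment> \<open>The only use of the value at T = c: it turns \<open>P\<close> into
    \<open>\<sigma> W - W\<close>.\<close>
  have Pc: "poly P c' = U' ^ (N + 1) * (1 + U' * g')"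
  proof (rule injD[OF inj_fract_mpoly])
    have "?h (poly P c') = poly (E W) c - W" using poly_F[of P c'] by (simp add: c' FP)
    also have "\<dots> = U ^ (N + 1) * f" using \<sigma>E[OF W_Rxyz, symmetric] \<sigma>_W by (simp add: specialize_def)
    also have "\<dots> = ?h (U' ^ (N + 1) * (1 + U' * g'))" by (simp only: h_simps hU g')
    finally show "?h (poly P c') = ?h (U' ^ (N + 1) * (1 + U' * g'))" .
  qed
  have d0: "d > 0" using d(1) by simp
  show False
    by (rule no_exponential_core[OF p CHAR' d(2) d0 qp Uq qv e0 qy W'_def
          poly0[OF H R_gens(3)] poly0[OF FP W_Rxyz] H' P_def Pc])
qed

end

theorem theorem4p15:
  fixes p l d a b :: nat
    and u :: "'r::{factorial_semiring, idom}"
    and R k Z Rxyz kxyz :: "'r fract mpolys set"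
    and x y U lam xt yt g :: "'r fract mpolys"
    and \<sigma> :: "'r fract mpolys \<Rightarrow> 'r fract mpolys"
  assumes "prime p" and "CHAR('r) = p"
    and "\<exists>r::'r. r \<noteq> 0 \<and> \<not> r dvd 1"
  defines "R \<equiv> range (\<lambda>r. Const (to_fract r))"
    and "k \<equiv> range Const"
    and "x \<equiv> Var 0" and "y \<equiv> Var 1" and "Z \<equiv> (\<lambda>i. Var (i + 1)) ` {1..l}"
    and "Rxyz \<equiv> adjoin R ({x, y} \<union> Z)"
    and "kxyz \<equiv> adjoin k ({x, y} \<union> Z)"
  assumes "u \<noteq> 0" and "\<not> u dvd 1"
    and "d \<ge> 2" and "\<not> p dvd d"
  defines "U \<equiv> Const (to_fract u)"
    and "a \<equiv> p - 2 + (p - 1)\<^sup>2 * (d - 1)"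
    and "b \<equiv> (p + 1) * (d - 1) + 1"
    and "lam \<equiv> Const (inverse (to_fract u) ^ (p + 1)) * y ^ (p * (p - 1))
             + Const (inverse (to_fract u) ^ 2) * y ^ (p * a + 1)"
    and "xt \<equiv> x + lam"
    and "yt \<equiv> y + xt ^ d"
  assumes "g \<in> adjoin R ({U ^ ((p + 1) * d) * yt} \<union> Z)"
    and "alg_automorphism k kxyz \<sigma>"
    and "\<sigma> xt = xt + U ^ b * (1 + U * g)" and "\<sigma> yt = yt" and "\<forall>z\<in>Z. \<sigma> z = z"
  shows "kxyz = adjoin k ({xt, yt} \<union> Z) \<and>
         alg_automorphism R Rxyz \<sigma> \<and>
         (f_stable_over (1 + U * g) k (adjoin k ({yt} \<union> Z))
            \<longrightarrow> \<not> exponential_over R Rxyz \<sigma>)"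
proof -
  have "wild_automorphism p l d a b u R k Z Rxyz kxyz x y U lam xt yt g \<sigma>"
    by (rule wild_automorphism.intro;
        (fact assms | rule meta_eq_to_obj_eq, fact assms | rule bspec[OF \<open>\<forall>z\<in>Z. \<sigma> z = z\<close>]))
  then interpret wild_automorphism p l d a b u R k Z Rxyz kxyz x y U lam xt yt g \<sigma> .
  show ?thesis
    \<comment> \<open>Simplification turns \<open>{yt} \<union> Z\<close> into
      \<open>insert yt Z\<close>, the form in which \<open>A\<close> is written.\<close>
    using kxyz_eq \<sigma>_restrict not_exponential by simp
qed

end
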